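(* Let $T$ be an inverse semigroup, $A$ a $T$-module with structure $(\theta,\eta)$, and $c\in Z^3_\le(T^1,A^1)$ a normalized order-preserving $3$-cocycle. Let $S,N,i,\beta,\pi$ (and $\alpha,\lambda$) be constructed from $T$, $A$ and $c$ as described in the context. Then the sequence $A\xrightarrow{i}N\xrightarrow{\beta}S\xrightarrow{\pi}T$, with $(\alpha,\lambda,\beta)$ as the crossed $S$-module structure on $N$, is a crossed module extension of the $T$-module $A$ by $T$ (i.e. a crossed module extension inducing the given structure $(\theta,\eta)$).
   Context: **Basics.** For an inverse semigroup $T$, $E(T)$ is its semilattice of idempotents, $\le$ is the natural partial order, $\mathbf r(t)=tt^{-1}$, $\mathbf d(t)=t^{-1}t$. A semilattice of groups is an inverse semigroup $A$ that is a disjoint union of groups (equivalently, whose idempotents are central); for $e\in E(A)$, $A_e=\{a\in A: aa^{-1}=a^{-1}a=e\}$. An endomorphism $\varphi$ of a semilattice of groups $A$ is relatively invertible if there are $\bar\varphi\in\operatorname{End}A$ and $e_\varphi\in E(A)$ such that $\bar\varphi(\varphi(a))=e_\varphi a$ and $\varphi(\bar\varphi(a))=\varphi(e_\varphi)a$ for all $a\in A$, $e_\varphi$ is the identity of $\bar\varphi(A)$ and $\varphi(e_\varphi)$ is the identity of $\varphi(A)$; $\operatorname{end}A$ is the set of these, an inverse subsemigroup of $\operatorname{End}A$. **Modules and cocycles.** A $T$-module is a semilattice of abelian groups $A$ with an isomorphism $\theta:E(T)\to E(A)$ and a homomorphism $\eta:T\to\operatorname{end}A$ such that $\eta_e(a)=\theta(e)a$,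 $\eta_t(\theta(e))=\theta(tet^{-1})$ for $e\in E(T)$, $t\in T$, $a\in A$. $C^n(T^1,A^1)$ is the group of functions $f:T^n\to A$ with $f(x_1,\dots,x_n)\in A_{\theta(\mathbf r(x_1\cdots x_n))}$; $(\delta^nf)(x_1,\dots,x_{n+1})=\eta_{x_1}(f(x_2,\dots,x_{n+1}))\prod_{i=1}^nf(x_1,\dots,x_ix_{i+1},\dots,x_{n+1})^{(-1)^i}f(x_1,\dots,x_n)^{(-1)^{n+1}}$. $f$ is order-preserving if $x_j\le y_j$ for all $j$ implies $f(x_1,\dots,x_n)\le f(y_1,\dots,y_n)$; $C^n_\le(T^1,A^1)$ is the group of order-preserving cochains and $Z^3_\le(T^1,A^1)=\ker\delta^3\cap C^3_\le(T^1,A^1)$. A $3$-cochain $c$ is normalized if $c(e,ex,y)=\theta(\mathbf r(exy))$, $c(xe,e,ey)=\theta(\mathbf r(xey))$ and $c(x,ye,e)=\theta(\mathbf r(xye))$ for all $x,y\in T$, $e\in E(T)$. **Crossed modules and extensions.** A crossed $S$-module ($S$ an inverse semigroup) is a semilattice of groups $N$ with $(\alpha,\lambda,\beta)$, where $\alpha:E(S)\to E(N)$ is an isomorphism, $\lambda:S\to\operatorname{end}N$ a homomorphism, $\beta:N\to S$ a homomorphism injective on idempotents with $\beta|_{E(N)}=\alpha^{-1}$, such that $\lambda_e(n)=\alpha(e)n$, $\lambda_s(\alpha(e))=\alpha(ses^{-1})$, $\lambda_{\beta(n)}(n')=nn'n^{-1}$, $\beta(\lambda_s(n))=s\beta(n)s^{-1}$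 for all $e\in E(S)$, $s\in S$, $n,n'\in N$. A crossed module extension of $A$ by $T$ is a sequence $A\xrightarrow{i}N\xrightarrow{\beta}S\xrightarrow{\pi}T$ where $N$ is a crossed $S$-module with structure $(\alpha,\lambda,\beta)$, $i$ is a monomorphism, $\pi$ an epimorphism injective on idempotents, $i(A)=\beta^{-1}(E(S))$, $\beta(N)=\pi^{-1}(E(T))$. The induced $T$-module structure on $A$ is $i^{-1}\circ\alpha\circ(\pi|_{E(S)})^{-1}$ on $E(T)$, and $t\mapsto i^{-1}\circ\lambda_s\circ i$ (any $s$ with $\pi(s)=t$) on $T$. **Construction: the semigroups $S$ and $N$.** $F(X)$, $F(X)^1$, $FG(X)$ are the free semigroup, monoid, group on $X$. View $T$ as an alphabet of letters $[t]$ ($t\in T$), and let $T^{-1}$ be a disjoint alphabet of letters $[t]^{-1}$ ($t\in T$). Let $\varphi:F(T\sqcup T^{-1})\to T$ be the homomorphism with $[t]\mapsto t$, $[t]^{-1}\mapsto t^{-1}$. Let $\epsilon$ be the identity of $FG(T)$ (the free group on the letters $[t]$); for $w\in FG(T)\setminus\{\epsilon\}$ let $\operatorname{irr}(w)\in F(T\sqcup T^{-1})$ be the reduced word representing $w$. Let $T^1=T\sqcup\{1\}$ with a new identity $1$ (so $t\le1$ iff $t\in E(T)$), and define $\nu:FG(T)\to T^1$ by $\nu(w)=\varphi(\operatorname{irr}(w))$ if $w\ne\epsilon$, $\nu(\epsilon)=1$. Put $S=\{(t,w)\in T\times FG(T): t\le\nu(w)\}$ with coordinatewise multiplication (an inverse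 semigroup with $E(S)=E(T)\times\{\epsilon\}$), $\pi:S\to T$, $\pi(t,w)=t$. Put $N=\{(a,e,w)\in A\times E(T)\times FG(T): a\in A_{\theta(e)},\ e\le\nu(w)\}$ with coordinatewise multiplication. Define $i(a)=(a,\theta^{-1}(aa^{-1}),\epsilon)$, $\alpha(e,\epsilon)=(\theta(e),e,\epsilon)$, $\beta(a,e,w)=(e,w)$. **Construction: the map $\lambda$.** For $t\in T$ define $\xi_t:F(T\sqcup T^{-1})\to A$ recursively, for $x,y\in T$, $u,v\in F(T\sqcup T^{-1})^1$: $\xi_t([x]^{-1}u)=c(t,x^{-1},x)^{-1}\xi_t([x^{-1}]u)$; $\xi_t([x])=\theta(\mathbf r(tx))$; $\xi_t([x][y]v)=c(t,x,y)\,\xi_t([xy]v)$; $\xi_t([x][y]^{-1}v)=c(t,xy^{-1},y)^{-1}\xi_t([xy^{-1}]v)$. Define $\zeta_t:FG(T)\to A$ by $\zeta_t(w)=\xi_t(\operatorname{irr}(w))$ for $w\ne\epsilon$ and $\zeta_t(\epsilon)=\theta(\mathbf r(t))$. Define maps $\gamma_t,\gamma_t^{-1}:N\to N$ by $\gamma_t(a,e,w)=(\zeta_t(w)\eta_t(a),tet^{-1},[t]w[t]^{-1})$ and $\gamma_t^{-1}(a,e,w)=(\zeta_{t^{-1}}(w)\eta_{t^{-1}}(a),t^{-1}et,[t]^{-1}w[t])$. For $s=(t,u)\in S$ and $n\in N$ put $\lambda_s(n)=\alpha(\mathbf r(s))\,(\gamma_{t_1}^{\varepsilon_1}\circ\dots\circ\gamma_{t_k}^{\varepsilon_k})(n)$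 if $u\ne\epsilon$ and $\operatorname{irr}(u)=[t_1]^{\varepsilon_1}\cdots[t_k]^{\varepsilon_k}$ ($\varepsilon_j\in\{-1,1\}$), and $\lambda_s(n)=\alpha(s)n$ if $u=\epsilon$. *)

theory Defs
  imports "HOL-Algebra.Group" "HOL-Library.Disjoint_Sets"
begin

section \<open>Inverse semigroups\<close>

record 'a sgrp = "'a partial_object" +
  sgmult :: "['a, 'a] \<Rightarrow> 'a"  (infixl \<open>\<cdot>\<index>\<close> 70)

definition is_inverse_of :: "('a, 'm) sgrp_scheme \<Rightarrow> 'a \<Rightarrow> 'a \<Rightarrow> bool" where
  "is_inverse_of G x y \<longleftrightarrow> y \<in> carrier G \<and> x \<cdot>\<^bsub>G\<^esub> y \<cdot>\<^bsub>G\<^esub> x = x \<and> y \<cdot>\<^bsub>G\<^esub> x \<cdot>\<^bsub>G\<^esub> y = y"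

locale inverse_semigroup =
  fixes G (structure)
  assumes closed: "\<lbrakk>x \<in> carrier G; y \<in> carrier G\<rbrakk> \<Longrightarrow> x \<cdot> y \<in> carrier G"
    and assoc: "\<lbrakk>x \<in> carrier G; y \<in> carrier G; z \<in> carrier G\<rbrakk> \<Longrightarrow> x \<cdot> y \<cdot> z = x \<cdot> (y \<cdot> z)"
    and ex1_inverse: "x \<in> carrier G \<Longrightarrow> \<exists>!y. is_inverse_of G x y"

definition sinv :: "('a, 'm) sgrp_scheme \<Rightarrow> 'a \<Rightarrow> 'a" where
  "sinv G x = (THE y. is_inverse_of G x y)"

definition idems :: "('a, 'm) sgrp_scheme \<Rightarrow> 'a set" where
  "idems G = {e \<in> carrier G. e \<cdot>\<^bsub>G\<^esub> e = e}"

definition idem_sgrp :: "('a, 'm) sgrp_scheme \<Rightarrow> 'a sgrp" where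
  "idem_sgrp G = \<lparr>carrier = idems G, sgmult = sgmult G\<rparr>"

definition nat_le :: "('a, 'm) sgrp_scheme \<Rightarrow> 'a \<Rightarrow> 'a \<Rightarrow> bool" where
  "nat_le G x y \<longleftrightarrow> x \<in> carrier G \<and> y \<in> carrier G \<and> (\<exists>e \<in> idems G. x = e \<cdot>\<^bsub>G\<^esub> y)"

definition ran_idem :: "('a, 'm) sgrp_scheme \<Rightarrow> 'a \<Rightarrow> 'a" where
  "ran_idem G t = t \<cdot>\<^bsub>G\<^esub> sinv G t"

text \<open>The product \<open>x\<^sub>1 \<cdots> x\<^sub>n\<close> of a nonempty list; the value on the empty list is irrelevant.\<close>

fun sprod :: "('a, 'm) sgrp_scheme \<Rightarrow> 'a list \<Rightarrow> 'a" where
  "sprod G [] = undefined"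
| "sprod G (x # xs) = foldl (\<lambda>a b. a \<cdot>\<^bsub>G\<^esub> b) x xs"

definition sg_hom :: "('a, 'm) sgrp_scheme \<Rightarrow> ('b, 'n) sgrp_scheme \<Rightarrow> ('a \<Rightarrow> 'b) set" where
  "sg_hom G H = {h \<in> carrier G \<rightarrow> carrier H.
     \<forall>x \<in> carrier G. \<forall>y \<in> carrier G. h (x \<cdot>\<^bsub>G\<^esub> y) = h x \<cdot>\<^bsub>H\<^esub> h y}"

definition sg_iso :: "('a, 'm) sgrp_scheme \<Rightarrow> ('b, 'n) sgrp_scheme \<Rightarrow> ('a \<Rightarrow> 'b) set" where
  "sg_iso G H = {h \<in> sg_hom G H. bij_betw h (carrier G) (carrier H)}"


section \<open>Semilattices of groups and relatively invertible endomorphisms\<close>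

definition semilattice_of_groups :: "('a, 'm) sgrp_scheme \<Rightarrow> bool" where
  "semilattice_of_groups A \<longleftrightarrow> inverse_semigroup A \<and>
     (\<exists>P. partition_on (carrier A) P \<and>
          (\<forall>H \<in> P. \<exists>e. group \<lparr>carrier = H, monoid.mult = sgmult A, one = e\<rparr>))"

definition component :: "('a, 'm) sgrp_scheme \<Rightarrow> 'a \<Rightarrow> 'a set" where
  "component A e = {a \<in> carrier A. a \<cdot>\<^bsub>A\<^esub> sinv A a = e \<and> sinv A a \<cdot>\<^bsub>A\<^esub> a = e}"

definition semilattice_of_abelian_groups :: "('a, 'm) sgrp_scheme \<Rightarrow> bool" where
  "semilattice_of_abelian_groups A \<longleftrightarrow> semilattice_of_groups A \<and>
     (\<forall>e \<in> idems A. \<forall>a \<in> component A e. \<forall>b \<in> component A e. a \<cdot>\<^bsub>A\<^esub> b = b \<cdot>\<^bsub>A\<^esub> a)"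

definition is_identity_of :: "('a, 'm) sgrp_scheme \<Rightarrow> 'a set \<Rightarrow> 'a \<Rightarrow> bool" where
  "is_identity_of A B e \<longleftrightarrow> e \<in> B \<and> (\<forall>b \<in> B. e \<cdot>\<^bsub>A\<^esub> b = b \<and> b \<cdot>\<^bsub>A\<^esub> e = b)"

definition relatively_invertible :: "('a, 'm) sgrp_scheme \<Rightarrow> ('a \<Rightarrow> 'a) \<Rightarrow> bool" where
  "relatively_invertible A \<phi> \<longleftrightarrow> (\<exists>\<psi> \<in> sg_hom A A. \<exists>e \<in> idems A.
     (\<forall>a \<in> carrier A. \<psi> (\<phi> a) = e \<cdot>\<^bsub>A\<^esub> a \<and> \<phi> (\<psi> a) = \<phi> e \<cdot>\<^bsub>A\<^esub> a) \<and>
     is_identity_of A (\<psi> ` carrier A) e \<and> is_identity_of A (\<phi> ` carrier A) (\<phi> e))"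

text \<open>
  The semigroup \<open>end A\<close>. Maps \<open>A \<rightarrow> A\<close> are represented by functions that are extensional on the
  carrier, so that equality of functions is equality of maps.
\<close>

definition rel_End :: "('a, 'm) sgrp_scheme \<Rightarrow> ('a \<Rightarrow> 'a) sgrp" where
  "rel_End A = \<lparr>carrier = {\<phi> \<in> sg_hom A A \<inter> extensional (carrier A). relatively_invertible A \<phi>},
                sgmult = compose (carrier A)\<rparr>"


section \<open>Modules and cochains\<close>

definition T_module ::
  "('t, 'm) sgrp_scheme \<Rightarrow> ('a, 'n) sgrp_scheme \<Rightarrow> ('t \<Rightarrow> 'a) \<Rightarrow> ('t \<Rightarrow> 'a \<Rightarrow> 'a) \<Rightarrow> bool" where
  "T_module T A \<theta> \<eta> \<longleftrightarrow>
     inverse_semigroup T \<and> semilattice_of_abelian_groups A \<and>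
     \<theta> \<in> sg_iso (idem_sgrp T) (idem_sgrp A) \<and> \<eta> \<in> sg_hom T (rel_End A) \<and>
     (\<forall>e \<in> idems T. \<forall>a \<in> carrier A. \<eta> e a = \<theta> e \<cdot>\<^bsub>A\<^esub> a) \<and>
     (\<forall>t \<in> carrier T. \<forall>e \<in> idems T. \<eta> t (\<theta> e) = \<theta> (t \<cdot>\<^bsub>T\<^esub> e \<cdot>\<^bsub>T\<^esub> sinv T t))"

text \<open>
  An \<open>n\<close>-cochain is a function of \<open>n\<close>-tuples, represented as lists of length \<open>n\<close> (\<open>n \<ge> 1\<close>);
  its values on all other lists are irrelevant.
\<close>

definition tuples :: "('t, 'm) sgrp_scheme \<Rightarrow> nat \<Rightarrow> 't list set" where
  "tuples T n = {xs. set xs \<subseteq> carrier T \<and> length xs = n}"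

definition cochains ::
  "('t, 'm) sgrp_scheme \<Rightarrow> ('a, 'n) sgrp_scheme \<Rightarrow> ('t \<Rightarrow> 'a) \<Rightarrow> nat \<Rightarrow> ('t list \<Rightarrow> 'a) set" where
  "cochains T A \<theta> n = {f. \<forall>xs \<in> tuples T n. f xs \<in> component A (\<theta> (ran_idem T (sprod T xs)))}"

definition order_preserving_cochains ::
  "('t, 'm) sgrp_scheme \<Rightarrow> ('a, 'n) sgrp_scheme \<Rightarrow> ('t \<Rightarrow> 'a) \<Rightarrow> nat \<Rightarrow> ('t list \<Rightarrow> 'a) set" where
  "order_preserving_cochains T A \<theta> n = {f \<in> cochains T A \<theta> n.
     \<forall>xs \<in> tuples T n. \<forall>ys \<in> tuples T n. list_all2 (nat_le T) xs ys \<longrightarrow> nat_le A (f xs) (f ys)}"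

text \<open>\<open>alt A k a\<close> is \<open>a\<close> raised to the power \<open>(-1)\<^sup>k\<close>.\<close>

definition alt :: "('a, 'n) sgrp_scheme \<Rightarrow> nat \<Rightarrow> 'a \<Rightarrow> 'a" where
  "alt A k a = (if even k then a else sinv A a)"

text \<open>List positions are counted from 0, so \<open>x\<^sub>i\<close> is \<open>xs ! (i - 1)\<close>.\<close>

definition coboundary ::
  "('t, 'm) sgrp_scheme \<Rightarrow> ('a, 'n) sgrp_scheme \<Rightarrow> ('t \<Rightarrow> 'a \<Rightarrow> 'a) \<Rightarrow> nat
     \<Rightarrow> ('t list \<Rightarrow> 'a) \<Rightarrow> ('t list \<Rightarrow> 'a)" where
  "coboundary T A \<eta> n f xs = sprod A
     ([\<eta> (hd xs) (f (tl xs))] @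
      map (\<lambda>i. alt A i (f (take (i - 1) xs @ [xs ! (i - 1) \<cdot>\<^bsub>T\<^esub> xs ! i] @ drop (i + 1) xs))) [1..<n+1] @
      [alt A (n + 1) (f (butlast xs))])"

definition order_preserving_cocycles ::
  "('t, 'm) sgrp_scheme \<Rightarrow> ('a, 'n) sgrp_scheme \<Rightarrow> ('t \<Rightarrow> 'a) \<Rightarrow> ('t \<Rightarrow> 'a \<Rightarrow> 'a) \<Rightarrow> nat
     \<Rightarrow> ('t list \<Rightarrow> 'a) set" where
  "order_preserving_cocycles T A \<theta> \<eta> n = {f \<in> order_preserving_cochains T A \<theta> n.
     \<forall>xs \<in> tuples T (n + 1). coboundary T A \<eta> n f xs = \<theta> (ran_idem T (sprod T xs))}"

definition normalized3 ::
  "('t, 'm) sgrp_scheme \<Rightarrow> ('t \<Rightarrow> 'a) \<Rightarrow> ('t list \<Rightarrow> 'a) \<Rightarrow> bool" where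
  "normalized3 T \<theta> c \<longleftrightarrow> (\<forall>x \<in> carrier T. \<forall>y \<in> carrier T. \<forall>e \<in> idems T.
     c [e, e \<cdot>\<^bsub>T\<^esub> x, y] = \<theta> (ran_idem T (e \<cdot>\<^bsub>T\<^esub> x \<cdot>\<^bsub>T\<^esub> y)) \<and>
     c [x \<cdot>\<^bsub>T\<^esub> e, e, e \<cdot>\<^bsub>T\<^esub> y] = \<theta> (ran_idem T (x \<cdot>\<^bsub>T\<^esub> e \<cdot>\<^bsub>T\<^esub> y)) \<and>
     c [x, y \<cdot>\<^bsub>T\<^esub> e, e] = \<theta> (ran_idem T (x \<cdot>\<^bsub>T\<^esub> y \<cdot>\<^bsub>T\<^esub> e)))"


section \<open>Crossed modules and crossed module extensions\<close>

definition crossed_module ::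
  "('s, 'm) sgrp_scheme \<Rightarrow> ('n, 'k) sgrp_scheme \<Rightarrow> ('s \<Rightarrow> 'n) \<Rightarrow> ('s \<Rightarrow> 'n \<Rightarrow> 'n) \<Rightarrow> ('n \<Rightarrow> 's) \<Rightarrow> bool" where
  "crossed_module S N \<alpha> \<Lambda> \<beta> \<longleftrightarrow>
     inverse_semigroup S \<and> semilattice_of_groups N \<and>
     \<alpha> \<in> sg_iso (idem_sgrp S) (idem_sgrp N) \<and>
     \<Lambda> \<in> sg_hom S (rel_End N) \<and>
     \<beta> \<in> sg_hom N S \<and> inj_on \<beta> (idems N) \<and>
     (\<forall>f \<in> idems N. \<beta> f = inv_into (idems S) \<alpha> f) \<and>
     (\<forall>e \<in> idems S. \<forall>n \<in> carrier N. \<Lambda> e n = \<alpha> e \<cdot>\<^bsub>N\<^esub> n) \<and>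
     (\<forall>s \<in> carrier S. \<forall>e \<in> idems S. \<Lambda> s (\<alpha> e) = \<alpha> (s \<cdot>\<^bsub>S\<^esub> e \<cdot>\<^bsub>S\<^esub> sinv S s)) \<and>
     (\<forall>n \<in> carrier N. \<forall>n' \<in> carrier N. \<Lambda> (\<beta> n) n' = n \<cdot>\<^bsub>N\<^esub> n' \<cdot>\<^bsub>N\<^esub> sinv N n) \<and>
     (\<forall>s \<in> carrier S. \<forall>n \<in> carrier N. \<beta> (\<Lambda> s n) = s \<cdot>\<^bsub>S\<^esub> \<beta> n \<cdot>\<^bsub>S\<^esub> sinv S s)"

definition crossed_module_extension ::
  "('a, 'j) sgrp_scheme \<Rightarrow> ('a \<Rightarrow> 'n) \<Rightarrow> ('n, 'k) sgrp_scheme \<Rightarrow> ('n \<Rightarrow> 's) \<Rightarrow> ('s, 'm) sgrp_scheme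
     \<Rightarrow> ('s \<Rightarrow> 't) \<Rightarrow> ('t, 'l) sgrp_scheme \<Rightarrow> ('s \<Rightarrow> 'n) \<Rightarrow> ('s \<Rightarrow> 'n \<Rightarrow> 'n) \<Rightarrow> bool" where
  "crossed_module_extension A i N \<beta> S \<pi> T \<alpha> \<Lambda> \<longleftrightarrow>
     semilattice_of_abelian_groups A \<and> inverse_semigroup T \<and>
     crossed_module S N \<alpha> \<Lambda> \<beta> \<and>
     i \<in> sg_hom A N \<and> inj_on i (carrier A) \<and>
     \<pi> \<in> sg_hom S T \<and> \<pi> ` carrier S = carrier T \<and> inj_on \<pi> (idems S) \<and>
     i ` carrier A = {n \<in> carrier N. \<beta> n \<in> idems S} \<and>
     \<beta> ` carrier N = {s \<in> carrier S. \<pi> s \<in> idems T}"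

text \<open>
  \<open>(\<theta>, \<eta>)\<close> is the \<open>T\<close>-module structure on \<open>A\<close> induced by the extension; every \<open>s\<close> over \<open>t\<close> has
  to yield the same map \<open>\<eta> t\<close>.
\<close>

definition induces_module ::
  "('a, 'j) sgrp_scheme \<Rightarrow> ('a \<Rightarrow> 'n) \<Rightarrow> ('s, 'm) sgrp_scheme \<Rightarrow> ('s \<Rightarrow> 't) \<Rightarrow> ('t, 'l) sgrp_scheme
     \<Rightarrow> ('s \<Rightarrow> 'n) \<Rightarrow> ('s \<Rightarrow> 'n \<Rightarrow> 'n) \<Rightarrow> ('t \<Rightarrow> 'a) \<Rightarrow> ('t \<Rightarrow> 'a \<Rightarrow> 'a) \<Rightarrow> bool" where
  "induces_module A i S \<pi> T \<alpha> \<Lambda> \<theta> \<eta> \<longleftrightarrow>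
     (\<forall>e \<in> idems T. \<theta> e = inv_into (carrier A) i (\<alpha> (inv_into (idems S) \<pi> e))) \<and>
     (\<forall>t \<in> carrier T. \<forall>s \<in> carrier S. \<pi> s = t \<longrightarrow>
        (\<forall>a \<in> carrier A. \<eta> t a = inv_into (carrier A) i (\<Lambda> s (i a))))"


section \<open>Free groups\<close>

datatype 'x letter = Pos 'x | Neg 'x

fun letter_inv :: "'x letter \<Rightarrow> 'x letter" where
  "letter_inv (Pos x) = Neg x"
| "letter_inv (Neg x) = Pos x"

fun cancel_Cons :: "'x letter \<Rightarrow> 'x letter list \<Rightarrow> 'x letter list" where
  "cancel_Cons l [] = [l]"
| "cancel_Cons l (k # w) = (if k = letter_inv l then w else l # k # w)"

definition reduce :: "'x letter list \<Rightarrow> 'x letter list" where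
  "reduce w = foldr cancel_Cons w []"

definition reduced :: "'x letter list \<Rightarrow> bool" where
  "reduced = successively (\<lambda>l k. k \<noteq> letter_inv l)"

definition words :: "'x set \<Rightarrow> 'x letter list set" where
  "words X = {w. \<Union> (set_letter ` set w) \<subseteq> X}"

text \<open>
  The elements of the free group are the reduced words themselves, so \<open>irr\<close> is the identity and
  \<open>\<epsilon>\<close> is the empty word.
\<close>

definition FG :: "'x set \<Rightarrow> 'x letter list monoid" where
  "FG X = \<lparr>carrier = {w \<in> words X. reduced w}, monoid.mult = (\<lambda>u v. reduce (u @ v)), one = []\<rparr>"

lemma letter_inv_inv [simp]: "letter_inv (letter_inv l) = l"
  by (cases l) auto

lemma set_letter_inv [simp]: "set_letter (letter_inv l) = set_letter l"
  by (cases l) auto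

lemma reduced_Cons: "reduced (l # w) \<longleftrightarrow> reduced w \<and> (w = [] \<or> hd w \<noteq> letter_inv l)"
  unfolding reduced_def successively_Cons by auto

lemma reduced_Nil [simp]: "reduced []" by (simp add: reduced_def)

lemma reduced_cancel_Cons: "reduced w \<Longrightarrow> reduced (cancel_Cons l w)"
  by (cases w) (auto simp: reduced_Cons)

lemma cancel_Cons_inv: "reduced w \<Longrightarrow> cancel_Cons (letter_inv l) (cancel_Cons l w) = w"
  apply (cases w)
   apply (auto simp: reduced_Cons)
  subgoal for v by (cases v) (auto)
  done

lemma reduced_foldr: "reduced z \<Longrightarrow> reduced (foldr cancel_Cons w z)"
  by (induction w) (auto simp: reduced_cancel_Cons)

lemma reduced_reduce [simp]: "reduced (reduce w)"
  by (simp add: reduce_def reduced_foldr)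

lemma reduce_reduced: "reduced w \<Longrightarrow> reduce w = w"
  unfolding reduce_def
  apply (induction w)
   apply simp
  subgoal for l w by (cases w) (auto simp: reduced_Cons)
  done

lemma foldr_cancel_Cons:
  "reduced z \<Longrightarrow> foldr cancel_Cons (cancel_Cons l w) z = cancel_Cons l (foldr cancel_Cons w z)"
proof (cases w)
  case (Cons k v)
  assume z: "reduced z"
  have "cancel_Cons l (cancel_Cons (letter_inv l) (foldr cancel_Cons v z)) = foldr cancel_Cons v z"
    using cancel_Cons_inv[of "foldr cancel_Cons v z" "letter_inv l"] reduced_foldr[OF z] by simp
  with Cons show ?thesis by auto
qed simp

lemma foldr_reduce: "reduced z \<Longrightarrow> foldr cancel_Cons (reduce w) z = foldr cancel_Cons w z"
  by (induction w) (auto simp: reduce_def foldr_cancel_Cons)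

lemma reduce_append_left: "reduce (reduce u @ v) = reduce (u @ v)"
  using foldr_reduce[of "reduce v" u] by (simp add: reduce_def reduced_foldr)

lemma reduce_append_right: "reduce (u @ reduce v) = reduce (u @ v)"
  using reduce_reduced[of "reduce v"] by (simp add: reduce_def reduced_foldr)

lemma words_reduce: "w \<in> words X \<Longrightarrow> reduce w \<in> words X"
proof (induction w)
  case (Cons l w)
  have "cancel_Cons l v \<in> words X" if "v \<in> words X" "set_letter l \<subseteq> X" for v
    using that by (cases v) (auto simp: words_def)
  with Cons show ?case by (auto simp: reduce_def words_def)
qed (simp add: reduce_def)

lemma reduce_inv: "reduce (map letter_inv (rev w) @ w) = []"
proof -
  have "foldr cancel_Cons (map letter_inv (rev w)) (foldr cancel_Cons w z) = z" if "reduced z" for z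
    using that by (induction w arbitrary: z) (simp_all add: cancel_Cons_inv reduced_foldr)
  from this[of "[]"] show ?thesis by (simp add: reduce_def)
qed

theorem group_FG: "group (FG X)"
proof (rule groupI)
  show "\<exists>y \<in> carrier (FG X). y \<otimes>\<^bsub>FG X\<^esub> x = \<one>\<^bsub>FG X\<^esub>" if "x \<in> carrier (FG X)" for x
  proof
    have "map letter_inv (rev x) \<in> words X" using that by (auto simp: FG_def words_def)
    then show "reduce (map letter_inv (rev x)) \<in> carrier (FG X)"
      by (auto simp: FG_def words_reduce)
  qed (simp add: FG_def reduce_append_left reduce_inv)
next
  fix x y assume "x \<in> carrier (FG X)" "y \<in> carrier (FG X)"
  then have "x @ y \<in> words X" by (auto simp: FG_def words_def)
  then show "x \<otimes>\<^bsub>FG X\<^esub> y \<in> carrier (FG X)" by (simp add: FG_def words_reduce)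
qed (auto simp: FG_def words_def reduce_append_left reduce_append_right reduce_reduced)

theorem FG_universal:
  assumes "group H" and f: "f \<in> X \<rightarrow> carrier H"
  shows "\<exists>!h. h \<in> hom (FG X) H \<inter> extensional (carrier (FG X)) \<and> (\<forall>x \<in> X. h [Pos x] = f x)"
proof -
  interpret H: group H by fact
  interpret F: group "FG X" by (rule group_FG)
  define g where "g l = (case l of Pos x \<Rightarrow> f x | Neg x \<Rightarrow> inv\<^bsub>H\<^esub> f x)" for l
  define k where "k w = foldr (\<lambda>l a. g l \<otimes>\<^bsub>H\<^esub> a) w \<one>\<^bsub>H\<^esub>" for w
  have kC: "k (l # w) = g l \<otimes>\<^bsub>H\<^esub> k w" for l w by (simp add: k_def)
  have gc: "g l \<in> carrier H" if "set_letter l \<subseteq> X" for l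
    using that f by (cases l) (auto simp: g_def)
  have gi: "g l \<otimes>\<^bsub>H\<^esub> g (letter_inv l) = \<one>\<^bsub>H\<^esub>" if "set_letter l \<subseteq> X" for l
    using that f by (cases l) (auto simp: g_def Pi_iff)
  have kc: "k w \<in> carrier H" if "w \<in> words X" for w
    using that by (induction w) (auto simp: kC words_def gc, simp add: k_def)
  have kcc: "k (cancel_Cons l w) = g l \<otimes>\<^bsub>H\<^esub> k w" if "set_letter l \<subseteq> X" "w \<in> words X" for l w
  proof (cases w)
    case (Cons m v)
    then have "set_letter m \<subseteq> X" "v \<in> words X" using that by (auto simp: words_def)
    then show ?thesis using Cons that
      by (auto simp: kC H.m_assoc[symmetric] gc kc gi)
  qed (simp add: kC)
  have kr: "k (reduce w) = k w" if "w \<in> words X" for w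
    using that
  proof (induction w)
    case (Cons l w)
    then have "w \<in> words X" "set_letter l \<subseteq> X" by (auto simp: words_def)
    with Cons.IH show ?case using kcc[of l "reduce w"] words_reduce[of w X]
      by (simp add: reduce_def kC)
  qed (simp add: reduce_def)
  have ka: "k (u @ v) = k u \<otimes>\<^bsub>H\<^esub> k v" if "u \<in> words X" "v \<in> words X" for u v
    using that(1)
  proof (induction u)
    case Nil
    show ?case using that kc by (simp add: k_def[of "[]"])
  next
    case (Cons l u)
    then show ?case using that kc gc by (auto simp: kC words_def H.m_assoc)
  qed
  define h where "h = restrict k (carrier (FG X))"
  show ?thesis
  proof (rule ex1I[of _ h])
    have "h \<in> hom (FG X) H"
    proof (rule homI)
      fix x assume "x \<in> carrier (FG X)" then show "h x \<in> carrier H"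
        by (auto simp: h_def FG_def kc)
    next
      fix x y assume xy: "x \<in> carrier (FG X)" "y \<in> carrier (FG X)"
      then have w: "x \<in> words X" "y \<in> words X" by (auto simp: FG_def)
      then have "x @ y \<in> words X" by (auto simp: words_def)
      with w have "k (reduce (x @ y)) = k x \<otimes>\<^bsub>H\<^esub> k y" by (simp add: kr ka)
      then show "h (x \<otimes>\<^bsub>FG X\<^esub> y) = h x \<otimes>\<^bsub>H\<^esub> h y"
        using F.m_closed[OF xy] xy by (simp add: h_def) (simp add: FG_def)
    qed
    moreover have "h [Pos x] = f x" if "x \<in> X" for x
    proof -
      have "f x \<in> carrier H" using that f by auto
      with that show ?thesis by (simp add: h_def FG_def words_def reduced_def k_def g_def)
    qed
    ultimately show "h \<in> hom (FG X) H \<inter> extensional (carrier (FG X)) \<and> (\<forall>x \<in> X. h [Pos x] = f x)"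
      by (auto simp: h_def)
  next
    fix h' assume h': "h' \<in> hom (FG X) H \<inter> extensional (carrier (FG X)) \<and> (\<forall>x \<in> X. h' [Pos x] = f x)"
    then interpret h': group_hom "FG X" H h'
      by (unfold_locales) auto
    have lc: "[l] \<in> carrier (FG X)" if "set_letter l \<subseteq> X" for l
      using that by (auto simp: FG_def words_def reduced_def)
    have hg: "h' [l] = g l" if "set_letter l \<subseteq> X" for l
    proof (cases l)
      case (Pos x) then show ?thesis using h' that by (auto simp: g_def)
    next
      case (Neg x)
      have "[Neg x] \<otimes>\<^bsub>FG X\<^esub> [Pos x] = \<one>\<^bsub>FG X\<^esub>" by (simp add: FG_def reduce_def)
      then have "[Neg x] = inv\<^bsub>FG X\<^esub> [Pos x]"
        using that Neg by (intro F.inv_equality[symmetric]) (auto intro: lc)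
      then have "h' [Neg x] = inv\<^bsub>H\<^esub> h' [Pos x]" using that Neg lc[of "Pos x"] by simp
      then show ?thesis using h' that Neg by (auto simp: g_def)
    qed
    have hk: "h' w = k w" if "w \<in> carrier (FG X)" for w
      using that
    proof (induction w)
      case Nil
      then show ?case using h'.hom_one by (simp add: FG_def k_def)
    next
      case (Cons l w)
      then have w: "w \<in> carrier (FG X)" "set_letter l \<subseteq> X"
        by (auto simp: FG_def words_def reduced_Cons)
      have "[l] \<otimes>\<^bsub>FG X\<^esub> w = l # w"
        using Cons.prems reduce_reduced[of "l # w"] by (simp add: FG_def)
      then have "h' (l # w) = h' [l] \<otimes>\<^bsub>H\<^esub> h' w"
        using h'.hom_mult[OF lc[OF w(2)] w(1)] by simp
      then show ?case using Cons.IH w hg by (simp add: kC)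
    qed
    show "h' = h"
      using h' hk by (intro extensionalityI[of _ "carrier (FG X)"]) (auto simp: h_def)
  qed
qed


section \<open>The construction of \<open>S\<close> and \<open>N\<close>\<close>

fun letter_val :: "('t, 'm) sgrp_scheme \<Rightarrow> 't letter \<Rightarrow> 't" where
  "letter_val T (Pos t) = t"
| "letter_val T (Neg t) = sinv T t"

definition word_val :: "('t, 'm) sgrp_scheme \<Rightarrow> 't letter list \<Rightarrow> 't" where
  "word_val T w = sprod T (map (letter_val T) w)"

text \<open>\<open>T\<^sup>1\<close>; the new identity is \<open>None\<close>.\<close>

definition adjoin_one :: "('t, 'm) sgrp_scheme \<Rightarrow> 't option sgrp" where
  "adjoin_one T = \<lparr>carrier = insert None (Some ` carrier T),
     sgmult = (\<lambda>x y. case x of None \<Rightarrow> y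
                 | Some s \<Rightarrow> (case y of None \<Rightarrow> x | Some t \<Rightarrow> Some (s \<cdot>\<^bsub>T\<^esub> t)))\<rparr>"

definition nu :: "('t, 'm) sgrp_scheme \<Rightarrow> 't letter list \<Rightarrow> 't option" where
  "nu T w = (if w = [] then None else Some (word_val T w))"

definition ext_S :: "('t, 'm) sgrp_scheme \<Rightarrow> ('t \<times> 't letter list) sgrp" where
  "ext_S T = \<lparr>
     carrier = {(t, w). t \<in> carrier T \<and> w \<in> carrier (FG (carrier T)) \<and>
                        nat_le (adjoin_one T) (Some t) (nu T w)},
     sgmult = (\<lambda>(t, w) (t', w'). (t \<cdot>\<^bsub>T\<^esub> t', w \<otimes>\<^bsub>FG (carrier T)\<^esub> w'))\<rparr>"

definition ext_N :: "('t, 'm) sgrp_scheme \<Rightarrow> ('a, 'n) sgrp_scheme \<Rightarrow> ('t \<Rightarrow> 'a)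
     \<Rightarrow> ('a \<times> 't \<times> 't letter list) sgrp" where
  "ext_N T A \<theta> = \<lparr>
     carrier = {(a, e, w). a \<in> carrier A \<and> e \<in> idems T \<and> w \<in> carrier (FG (carrier T)) \<and>
                           a \<in> component A (\<theta> e) \<and> nat_le (adjoin_one T) (Some e) (nu T w)},
     sgmult = (\<lambda>(a, e, w) (a', e', w').
                 (a \<cdot>\<^bsub>A\<^esub> a', e \<cdot>\<^bsub>T\<^esub> e', w \<otimes>\<^bsub>FG (carrier T)\<^esub> w'))\<rparr>"

definition ext_pi :: "'t \<times> 't letter list \<Rightarrow> 't" where
  "ext_pi = (\<lambda>(t, w). t)"

definition ext_i :: "('t, 'm) sgrp_scheme \<Rightarrow> ('a, 'n) sgrp_scheme \<Rightarrow> ('t \<Rightarrow> 'a)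
     \<Rightarrow> 'a \<Rightarrow> 'a \<times> 't \<times> 't letter list" where
  "ext_i T A \<theta> a = (a, inv_into (idems T) \<theta> (a \<cdot>\<^bsub>A\<^esub> sinv A a), [])"

text \<open>Only the values on idempotents matter, i.e. on pairs whose second component is empty.\<close>

definition ext_alpha :: "('t \<Rightarrow> 'a) \<Rightarrow> 't \<times> 't letter list \<Rightarrow> 'a \<times> 't \<times> 't letter list" where
  "ext_alpha \<theta> = (\<lambda>(e, w). (\<theta> e, e, []))"

definition ext_beta :: "'a \<times> 't \<times> 't letter list \<Rightarrow> 't \<times> 't letter list" where
  "ext_beta = (\<lambda>(a, e, w). (e, w))"


section \<open>The construction of \<open>\<lambda>\<close>\<close>

text \<open>The value of \<open>\<xi>\<^sub>t\<close> on the empty word is irrelevant.\<close>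

function xi :: "('t, 'm) sgrp_scheme \<Rightarrow> ('a, 'n) sgrp_scheme \<Rightarrow> ('t \<Rightarrow> 'a) \<Rightarrow> ('t list \<Rightarrow> 'a)
     \<Rightarrow> 't \<Rightarrow> 't letter list \<Rightarrow> 'a" where
  "xi T A \<theta> c t [] = undefined"
| "xi T A \<theta> c t (Neg x # u) = sinv A (c [t, sinv T x, x]) \<cdot>\<^bsub>A\<^esub> xi T A \<theta> c t (Pos (sinv T x) # u)"
| "xi T A \<theta> c t [Pos x] = \<theta> (ran_idem T (t \<cdot>\<^bsub>T\<^esub> x))"
| "xi T A \<theta> c t (Pos x # Pos y # v) = c [t, x, y] \<cdot>\<^bsub>A\<^esub> xi T A \<theta> c t (Pos (x \<cdot>\<^bsub>T\<^esub> y) # v)"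
| "xi T A \<theta> c t (Pos x # Neg y # v) =
     sinv A (c [t, x \<cdot>\<^bsub>T\<^esub> sinv T y, y]) \<cdot>\<^bsub>A\<^esub> xi T A \<theta> c t (Pos (x \<cdot>\<^bsub>T\<^esub> sinv T y) # v)"
  by pat_completeness auto
termination
  by (relation "measure (\<lambda>(T, A, \<theta>, c, t, w). 2 * length w +
        (case w of Neg x # u \<Rightarrow> 1 | _ \<Rightarrow> 0))") auto

definition zeta :: "('t, 'm) sgrp_scheme \<Rightarrow> ('a, 'n) sgrp_scheme \<Rightarrow> ('t \<Rightarrow> 'a) \<Rightarrow> ('t list \<Rightarrow> 'a)
     \<Rightarrow> 't \<Rightarrow> 't letter list \<Rightarrow> 'a" where
  "zeta T A \<theta> c t w = (if w = [] then \<theta> (ran_idem T t) else xi T A \<theta> c t w)"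

text \<open>
  For \<open>l = [t]\<^sup>\<epsilon>\<close> with \<open>\<epsilon> \<in> {-1, 1}\<close>, \<open>gam T A \<theta> \<eta> c l\<close> is the map \<open>\<gamma>\<^sub>t\<^sup>\<epsilon>\<close>.
\<close>

fun gam :: "('t, 'm) sgrp_scheme \<Rightarrow> ('a, 'n) sgrp_scheme \<Rightarrow> ('t \<Rightarrow> 'a) \<Rightarrow> ('t \<Rightarrow> 'a \<Rightarrow> 'a)
     \<Rightarrow> ('t list \<Rightarrow> 'a) \<Rightarrow> 't letter
     \<Rightarrow> 'a \<times> 't \<times> 't letter list \<Rightarrow> 'a \<times> 't \<times> 't letter list" where
  "gam T A \<theta> \<eta> c (Pos t) (a, e, w) =
     (zeta T A \<theta> c t w \<cdot>\<^bsub>A\<^esub> \<eta> t a,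
      t \<cdot>\<^bsub>T\<^esub> e \<cdot>\<^bsub>T\<^esub> sinv T t,
      [Pos t] \<otimes>\<^bsub>FG (carrier T)\<^esub> w \<otimes>\<^bsub>FG (carrier T)\<^esub> [Neg t])"
| "gam T A \<theta> \<eta> c (Neg t) (a, e, w) =
     (zeta T A \<theta> c (sinv T t) w \<cdot>\<^bsub>A\<^esub> \<eta> (sinv T t) a,
      sinv T t \<cdot>\<^bsub>T\<^esub> e \<cdot>\<^bsub>T\<^esub> t,
      [Neg t] \<otimes>\<^bsub>FG (carrier T)\<^esub> w \<otimes>\<^bsub>FG (carrier T)\<^esub> [Pos t])"

definition ext_lambda :: "('t, 'm) sgrp_scheme \<Rightarrow> ('a, 'n) sgrp_scheme \<Rightarrow> ('t \<Rightarrow> 'a)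
     \<Rightarrow> ('t \<Rightarrow> 'a \<Rightarrow> 'a) \<Rightarrow> ('t list \<Rightarrow> 'a) \<Rightarrow> 't \<times> 't letter list
     \<Rightarrow> 'a \<times> 't \<times> 't letter list \<Rightarrow> 'a \<times> 't \<times> 't letter list" where
  "ext_lambda T A \<theta> \<eta> c = (\<lambda>(t, u). \<lambda>n \<in> carrier (ext_N T A \<theta>).
     if u = [] then ext_alpha \<theta> (t, u) \<cdot>\<^bsub>ext_N T A \<theta>\<^esub> n
     else ext_alpha \<theta> (ran_idem (ext_S T) (t, u)) \<cdot>\<^bsub>ext_N T A \<theta>\<^esub> foldr (gam T A \<theta> \<eta> c) u n)"

end

theory Submission
  imports Defs
begin

text \<open>
  Reading a word \<open>w\<close> after a prefix of value \<open>x\<close> contributes a factor \<open>twist t x w\<close> to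
  \<open>\<xi>\<^sub>t\<close>. Order preservation and normalization make this factor insensitive, up to idempotents
  of \<open>A\<close>, to free reduction of \<open>w\<close>, so that the contributions of \<open>u\<close> and \<open>u\<^sup>-\<^sup>1\<close> to a
  conjugate \<open>u w u\<^sup>-\<^sup>1\<close> cancel; telescoping the cocycle identity
  along \<open>w\<close> gives
  \<open>\<eta>\<^sub>s(twist t e w) twist s (te) w = twist (st) e w\<close> whenever \<open>e \<le> \<nu>(w)\<close> is idempotent.
  Hence \<open>\<lambda>\<^sub>s(a, e, w) = (twist t e w \<eta>\<^sub>t(a), t e t\<^sup>-\<^sup>1, u w u\<^sup>-\<^sup>1)\<close> for all \<open>s = (t, u)\<close>, the
  cocycle contribution depending on \<open>t\<close> alone, and in this form the homomorphism properties
  and the crossed module axioms are direct computations.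
\<close>

section \<open>Inverse semigroups and semilattices of groups\<close>

text \<open>Free reduction does not preserve values: in \<open>T\<close> a cancelled pair of letters
  has an idempotent as its value, not an identity, so deleting it only moves the value up in the
  natural order, and \<open>twist\<close> moves up with it because \<open>c\<close> is
  order-preserving. Statements about reduced words therefore arise as inequalities. They become
  equalities through one fact: comparable elements of \<open>A\<close> with the same range
  idempotent coincide. Each such identity thus needs a monotonicity argument and a range
  computation. The ranges agree because an idempotent \<open>e\<close> with
  \<open>e \<le> \<nu>(w)\<close> is fixed by reading \<open>w\<close>. The same fact disposes of
  the boundary terms in the telescoped cocycle identity: they are \<open>c [s, t, x]\<close> at the
  two ends of the word, and for \<open>x = e\<close> both equal \<open>c [s, t, e]\<close>, an
  idempotent by normalization. Finally, \<open>\<zeta>\<close> starts at the first letter of a word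
  and \<open>twist\<close> at an idempotent. The two values are only comparable, but they agree
  after multiplication by \<open>\<eta> t a\<close>, whose range idempotent is that of the smaller
  one.\<close>

context inverse_semigroup
begin

lemma is_inverse_of_sinv: "x \<in> carrier G \<Longrightarrow> is_inverse_of G x (sinv G x)"
  unfolding sinv_def using theI'[OF ex1_inverse] .

lemma sinv_eqI: "\<lbrakk>x \<in> carrier G; is_inverse_of G x y\<rbrakk> \<Longrightarrow> sinv G x = y"
  using ex1_inverse is_inverse_of_sinv by blast

lemma sinv_closed [simp]: "x \<in> carrier G \<Longrightarrow> sinv G x \<in> carrier G"
  using is_inverse_of_sinv by (auto simp: is_inverse_of_def)

declare closed [simp] assoc [simp]

lemma mult_sinv_mult [simp]: "x \<in> carrier G \<Longrightarrow> x \<cdot> (sinv G x \<cdot> x) = x"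
  using is_inverse_of_sinv[of x] by (auto simp: is_inverse_of_def)

lemma sinv_mult_sinv [simp]: "x \<in> carrier G \<Longrightarrow> sinv G x \<cdot> (x \<cdot> sinv G x) = sinv G x"
  using is_inverse_of_sinv[of x] by (auto simp: is_inverse_of_def)

lemma mult_sinv_mult_left [simp]:
  "\<lbrakk>x \<in> carrier G; y \<in> carrier G\<rbrakk> \<Longrightarrow> x \<cdot> (sinv G x \<cdot> (x \<cdot> y)) = x \<cdot> y"
  using mult_sinv_mult[of x] assoc[of x "sinv G x \<cdot> x" y] by simp

lemma sinv_mult_sinv_left [simp]:
  "\<lbrakk>x \<in> carrier G; y \<in> carrier G\<rbrakk> \<Longrightarrow> sinv G x \<cdot> (x \<cdot> (sinv G x \<cdot> y)) = sinv G x \<cdot> y"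
  using sinv_mult_sinv[of x] assoc[of "sinv G x" "x \<cdot> sinv G x" y] by simp

lemma sinv_sinv [simp]: "x \<in> carrier G \<Longrightarrow> sinv G (sinv G x) = x"
  by (rule sinv_eqI) (auto simp: is_inverse_of_def)

lemma idems_carrier [simp]: "e \<in> idems G \<Longrightarrow> e \<in> carrier G"
  by (simp add: idems_def)

lemma idem_mult_self [simp]: "e \<in> idems G \<Longrightarrow> e \<cdot> e = e"
  unfolding idems_def by blast

lemma idemsI: "\<lbrakk>e \<in> carrier G; e \<cdot> e = e\<rbrakk> \<Longrightarrow> e \<in> idems G"
  unfolding idems_def by blast

lemma idem_mult_self_left [simp]: "\<lbrakk>e \<in> idems G; x \<in> carrier G\<rbrakk> \<Longrightarrow> e \<cdot> (e \<cdot> x) = e \<cdot> x"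
  by (metis assoc idem_mult_self idems_carrier)

lemma sinv_idem [simp]: "e \<in> idems G \<Longrightarrow> sinv G e = e"
  by (rule sinv_eqI) (auto simp: is_inverse_of_def)

lemma mult_sinv_idem [simp]: "x \<in> carrier G \<Longrightarrow> x \<cdot> sinv G x \<in> idems G"
  by (rule idemsI) simp_all

lemma sinv_mult_idem [simp]: "x \<in> carrier G \<Longrightarrow> sinv G x \<cdot> x \<in> idems G"
  by (rule idemsI) simp_all

text \<open>The element \<open>f (e f)\<^sup>-\<^sup>1 e\<close> is an idempotent inverse of \<open>e f\<close>.\<close>

lemma idem_mult_idem [simp]:
  assumes e: "e \<in> idems G" and f: "f \<in> idems G"
  shows "e \<cdot> f \<in> idems G"
proof -
  define x where "x = sinv G (e \<cdot> f)"
  have x: "x \<in> carrier G" using e f by (simp add: x_def)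
  have 1: "e \<cdot> (f \<cdot> (x \<cdot> (e \<cdot> f))) = e \<cdot> f"
    using mult_sinv_mult[of "e \<cdot> f", folded x_def] e f x by (simp del: mult_sinv_mult)
  have 2: "x \<cdot> (e \<cdot> (f \<cdot> x)) = x"
    using sinv_mult_sinv[of "e \<cdot> f", folded x_def] e f x by (simp del: sinv_mult_sinv)
  have 3: "x \<cdot> (e \<cdot> (f \<cdot> (x \<cdot> e))) = x \<cdot> e"
    using 2 assoc[of x "e \<cdot> (f \<cdot> x)" e] e f x by simp
  have "is_inverse_of G (e \<cdot> f) (f \<cdot> (x \<cdot> e))"
    using e f x 1 3 by (simp add: is_inverse_of_def)
  then have fxe: "x = f \<cdot> (x \<cdot> e)"
    unfolding x_def using e f by (intro sinv_eqI) auto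
  have "x \<cdot> x = f \<cdot> (x \<cdot> (e \<cdot> (f \<cdot> (x \<cdot> e))))"
    by (subst (1 2) fxe) (use e f x in simp)
  also have "\<dots> = x" using 3 fxe by simp
  finally have "x \<in> idems G" using x by (intro idemsI)
  moreover have "sinv G x = e \<cdot> f" using e f by (simp add: x_def)
  ultimately show ?thesis by simp
qed

text \<open>Both products are idempotent, which makes \<open>f \<cdot> e\<close> an inverse of
  \<open>e \<cdot> f\<close>. An idempotent is its own inverse, so uniqueness of inverses identifies
  the two.\<close>

lemma idem_commute:
  assumes e: "e \<in> idems G" and f: "f \<in> idems G"
  shows "e \<cdot> f = f \<cdot> e"
proof -
  have "e \<cdot> (f \<cdot> (e \<cdot> f)) = e \<cdot> f" "f \<cdot> (e \<cdot> (f \<cdot> e)) = f \<cdot> e"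
    using idem_mult_self[OF idem_mult_idem[OF e f]] idem_mult_self[OF idem_mult_idem[OF f e]] e f
    by (simp_all del: idem_mult_self)
  then have "is_inverse_of G (e \<cdot> f) (f \<cdot> e)"
    using e f by (simp add: is_inverse_of_def)
  then have "sinv G (e \<cdot> f) = f \<cdot> e" using e f by (intro sinv_eqI) auto
  with e f show ?thesis by simp
qed

lemma idem_left_commute:
  "\<lbrakk>e \<in> idems G; f \<in> idems G; x \<in> carrier G\<rbrakk> \<Longrightarrow> e \<cdot> (f \<cdot> x) = f \<cdot> (e \<cdot> x)"
  by (metis assoc idem_commute idems_carrier)

lemma sinv_mult [simp]:
  assumes x: "x \<in> carrier G" and y: "y \<in> carrier G"
  shows "sinv G (x \<cdot> y) = sinv G y \<cdot> sinv G x"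
proof (rule sinv_eqI)
  \<comment> \<open>The commuting idempotents \<open>y y^-1\<close> and \<open>x^-1 x\<close> are
    needed with a trailing factor \<open>z\<close>, because \<open>assoc\<close> as a rewrite rule
    leaves all products nested to the right.\<close>
  have *: "y \<cdot> (sinv G y \<cdot> (sinv G x \<cdot> (x \<cdot> z))) = sinv G x \<cdot> (x \<cdot> (y \<cdot> (sinv G y \<cdot> z)))"
    if "z \<in> carrier G" for z
    using idem_left_commute[of "y \<cdot> sinv G y" "sinv G x \<cdot> x" z] x y that by simp
  have **: "sinv G x \<cdot> (x \<cdot> (y \<cdot> sinv G y)) = y \<cdot> (sinv G y \<cdot> (sinv G x \<cdot> x))"
    using idem_commute[of "y \<cdot> sinv G y" "sinv G x \<cdot> x"] x y by simp
  show "is_inverse_of G (x \<cdot> y) (sinv G y \<cdot> sinv G x)"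
    using x y *[of y] *[of "sinv G x", symmetric] by (simp add: is_inverse_of_def)
qed (use assms in simp)

lemma conj_idem [simp]:
  assumes t: "t \<in> carrier G" and e: "e \<in> idems G"
  shows "t \<cdot> (e \<cdot> sinv G t) \<in> idems G"
proof -
  have "sinv G t \<cdot> (t \<cdot> (e \<cdot> sinv G t)) = e \<cdot> sinv G t"
    using idem_left_commute[of "sinv G t \<cdot> t" e "sinv G t"] t e by simp
  then show ?thesis using t e by (intro idemsI) simp_all
qed

lemma mult_idem_swap:
  assumes t: "t \<in> carrier G" and e: "e \<in> idems G"
  shows "t \<cdot> (e \<cdot> (sinv G t \<cdot> t)) = t \<cdot> e"
  using idem_commute[of e "sinv G t \<cdot> t"] t e by simp

lemma ran_idem_idem [simp]: "x \<in> carrier G \<Longrightarrow> ran_idem G x \<in> idems G"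
  by (simp add: ran_idem_def)

lemma ran_idem_of_idem [simp]: "e \<in> idems G \<Longrightarrow> ran_idem G e = e"
  by (simp add: ran_idem_def)

lemma ran_idem_mult_self [simp]: "x \<in> carrier G \<Longrightarrow> ran_idem G x \<cdot> x = x"
  by (simp add: ran_idem_def)

lemma ran_idem_mult_idem:
  "\<lbrakk>x \<in> carrier G; e \<in> idems G\<rbrakk> \<Longrightarrow> ran_idem G (x \<cdot> e) = x \<cdot> e \<cdot> sinv G x"
  by (simp add: ran_idem_def)

lemma ran_idem_mult: "\<lbrakk>x \<in> carrier G; y \<in> carrier G\<rbrakk>
    \<Longrightarrow> ran_idem G (x \<cdot> y) = x \<cdot> (ran_idem G y \<cdot> sinv G x)"
  by (simp add: ran_idem_def)

section \<open>The natural partial order\<close>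

lemma nat_leI: "\<lbrakk>e \<in> idems G; y \<in> carrier G; x = e \<cdot> y\<rbrakk> \<Longrightarrow> nat_le G x y"
  by (auto simp: nat_le_def)

lemma nat_leE:
  assumes "nat_le G x y" obtains e where "e \<in> idems G" "x = e \<cdot> y" "x \<in> carrier G" "y \<in> carrier G"
  using assms by (auto simp: nat_le_def)

lemma nat_le_refl [simp]: "x \<in> carrier G \<Longrightarrow> nat_le G x x"
  by (rule nat_leI[of "ran_idem G x"]) simp_all

lemma nat_le_trans:
  assumes "nat_le G x y" "nat_le G y z" shows "nat_le G x z"
proof -
  obtain e f where *: "e \<in> idems G" "f \<in> idems G" "x = e \<cdot> y" "y = f \<cdot> z" "z \<in> carrier G"
    using assms by (auto simp: nat_le_def)
  then show ?thesis by (intro nat_leI[of "e \<cdot> f"]) simp_all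
qed

text \<open>If \<open>x = e y\<close>, then the range idempotent of \<open>x\<close> is
  \<open>e\<close> times that of \<open>y\<close>, and the latter fixes \<open>y\<close>. This
  replaces the unknown witness of \<open>x \<le> y\<close> by a canonical one.\<close>

lemma nat_le_ran: assumes "nat_le G x y" shows "x = ran_idem G x \<cdot> y"
proof -
  obtain e where *: "e \<in> idems G" "x = e \<cdot> y" "y \<in> carrier G"
    using assms by (auto simp: nat_le_def)
  have "ran_idem G x \<cdot> y = e \<cdot> ((y \<cdot> sinv G y) \<cdot> (e \<cdot> y))" using * by (simp add: ran_idem_def)
  also have "\<dots> = e \<cdot> y"
    using * idem_left_commute[of "y \<cdot> sinv G y" e y] by (metis assoc closed idem_mult_self_left
        idems_carrier mult_sinv_idem mult_sinv_mult sinv_closed)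
  finally show ?thesis using * by simp
qed

lemma mult_idem_conv:
  "\<lbrakk>y \<in> carrier G; e \<in> idems G\<rbrakk> \<Longrightarrow> y \<cdot> e = y \<cdot> (e \<cdot> sinv G y) \<cdot> y"
  using mult_idem_swap[of y e] by simp

lemma nat_le_mult_idem: "\<lbrakk>y \<in> carrier G; e \<in> idems G\<rbrakk> \<Longrightarrow> nat_le G (y \<cdot> e) y"
  by (rule nat_leI[of "y \<cdot> (e \<cdot> sinv G y)"]) (simp, simp, rule mult_idem_conv)

lemma nat_le_idem_mult: "\<lbrakk>y \<in> carrier G; e \<in> idems G\<rbrakk> \<Longrightarrow> nat_le G (e \<cdot> y) y"
  by (rule nat_leI[of e]) simp_all

text \<open>The inner idempotent is moved to the left by conjugation:
  \<open>e y f v = e (y f y^-1) y v\<close>.\<close>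

lemma nat_le_mult:
  assumes "nat_le G x y" "nat_le G u v" shows "nat_le G (x \<cdot> u) (y \<cdot> v)"
proof -
  obtain e f where *: "e \<in> idems G" "f \<in> idems G" "x = e \<cdot> y" "u = f \<cdot> v"
      "y \<in> carrier G" "v \<in> carrier G"
    using assms by (auto simp: nat_le_def)
  have "y \<cdot> (f \<cdot> (sinv G y \<cdot> (y \<cdot> v))) = y \<cdot> (f \<cdot> v)"
    using * idem_left_commute[of f "sinv G y \<cdot> y" v] by simp
  with * show ?thesis
    by (intro nat_leI[of "e \<cdot> (y \<cdot> (f \<cdot> sinv G y))"]) simp_all
qed

lemma nat_le_sinv:
  assumes "nat_le G x y" shows "nat_le G (sinv G x) (sinv G y)"
proof -
  obtain e where *: "e \<in> idems G" "x = e \<cdot> y" "y \<in> carrier G"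
    using assms by (auto simp: nat_le_def)
  then show ?thesis using nat_le_mult_idem[of "sinv G y" e] by simp
qed

lemma nat_le_ran_idem: "nat_le G x y \<Longrightarrow> nat_le G (ran_idem G x) (ran_idem G y)"
  unfolding ran_idem_def by (intro nat_le_mult nat_le_sinv)

lemma nat_le_carrier: "nat_le G x y \<Longrightarrow> x \<in> carrier G" "nat_le G x y \<Longrightarrow> y \<in> carrier G"
  by (auto simp: nat_le_def)

text \<open>The device that turns inequalities into equalities below: the canonical witness of
  \<open>x \<le> y\<close> is the range idempotent of \<open>x\<close>, and if it is also that of
  \<open>y\<close>, it fixes \<open>y\<close>.\<close>

lemma nat_le_ran_eq: "\<lbrakk>nat_le G x y; ran_idem G x = ran_idem G y\<rbrakk> \<Longrightarrow> x = y"
  using nat_le_ran[of x y] nat_le_carrier[of x y] by simp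

end

lemma sg_hom_closed: "\<lbrakk>h \<in> sg_hom G H; x \<in> carrier G\<rbrakk> \<Longrightarrow> h x \<in> carrier H"
  by (auto simp: sg_hom_def)

lemma sg_hom_mult:
  "\<lbrakk>h \<in> sg_hom G H; x \<in> carrier G; y \<in> carrier G\<rbrakk> \<Longrightarrow> h (x \<cdot>\<^bsub>G\<^esub> y) = h x \<cdot>\<^bsub>H\<^esub> h y"
  by (auto simp: sg_hom_def)

lemma sg_hom_sinv:
  assumes "inverse_semigroup G" "inverse_semigroup H" "h \<in> sg_hom G H" "x \<in> carrier G"
  shows "h (sinv G x) = sinv H (h x)"
proof -
  interpret G: inverse_semigroup G by fact
  interpret H: inverse_semigroup H by fact
  note h = sg_hom_closed[OF assms(3)] sg_hom_mult[OF assms(3), symmetric]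
  show ?thesis
    by (rule H.sinv_eqI[symmetric]) (use assms(4) in \<open>simp_all add: is_inverse_of_def h del: H.assoc\<close>)
qed


locale comm_inverse_semigroup = inverse_semigroup +
  assumes comm: "\<lbrakk>x \<in> carrier G; y \<in> carrier G\<rbrakk> \<Longrightarrow> x \<cdot> y = y \<cdot> x"
begin

lemma left_comm:
  "\<lbrakk>x \<in> carrier G; y \<in> carrier G; z \<in> carrier G\<rbrakk> \<Longrightarrow> x \<cdot> (y \<cdot> z) = y \<cdot> (x \<cdot> z)"
  by (metis assoc comm)

lemmas ac = comm left_comm

lemma component_iff: "a \<in> component G e \<longleftrightarrow> a \<in> carrier G \<and> ran_idem G a = e"
  by (auto simp: component_def ran_idem_def comm)

lemma ran_idem_mult_comm:
  "\<lbrakk>x \<in> carrier G; y \<in> carrier G\<rbrakk> \<Longrightarrow> ran_idem G (x \<cdot> y) = ran_idem G x \<cdot> ran_idem G y"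
  by (simp add: ran_idem_def ac)

lemma ran_idem_sinv [simp]: "x \<in> carrier G \<Longrightarrow> ran_idem G (sinv G x) = ran_idem G x"
  by (simp add: ran_idem_def comm)

end

text \<open>The inverse of \<open>x\<close> in its group is \<open>sinv A x\<close>, so \<open>x\<close> commutes with \<open>sinv A x\<close>; comparing
  the two range idempotents of \<open>e x\<close> then shows that idempotents are central.\<close>

lemma semilattice_of_groups_sinv_commute:
  assumes A: "semilattice_of_groups A" and x: "x \<in> carrier A"
  shows "x \<cdot>\<^bsub>A\<^esub> sinv A x = sinv A x \<cdot>\<^bsub>A\<^esub> x"
proof -
  interpret inverse_semigroup A using A by (simp add: semilattice_of_groups_def)
  obtain P where P: "partition_on (carrier A) P"
    and grp: "\<And>H. H \<in> P \<Longrightarrow> \<exists>e. group \<lparr>carrier = H, monoid.mult = sgmult A, one = e\<rparr>"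
    using A by (auto simp: semilattice_of_groups_def)
  obtain H where H: "H \<in> P" "x \<in> H" using P x by (auto simp: partition_on_def)
  have HA: "H \<subseteq> carrier A" using P H by (auto simp: partition_on_def)
  obtain e where "group \<lparr>carrier = H, monoid.mult = sgmult A, one = e\<rparr>" using grp H by blast
  then interpret H: group "\<lparr>carrier = H, monoid.mult = sgmult A, one = e\<rparr>" .
  let ?H = "\<lparr>carrier = H, monoid.mult = sgmult A, one = e\<rparr>"
  define y where "y = inv\<^bsub>?H\<^esub> x"
  have y: "y \<in> H" "x \<cdot>\<^bsub>A\<^esub> y = e" "y \<cdot>\<^bsub>A\<^esub> x = e"
    using H.inv_closed[of x] H.r_inv[of x] H.l_inv[of x] H by (auto simp: y_def)
  have "e \<cdot>\<^bsub>A\<^esub> x = x" "e \<cdot>\<^bsub>A\<^esub> y = y" using H.l_one[of x] H.l_one[of y] H y by auto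
  then have "is_inverse_of A x y" using y HA by (auto simp: is_inverse_of_def simp del: assoc)
  then show ?thesis using sinv_eqI[OF x] y by simp
qed

lemma semilattice_of_groups_idem_central:
  assumes A: "semilattice_of_groups A" and x: "x \<in> carrier A" and e: "e \<in> idems A"
  shows "x \<cdot>\<^bsub>A\<^esub> e = e \<cdot>\<^bsub>A\<^esub> x"
proof -
  interpret inverse_semigroup A using A by (simp add: semilattice_of_groups_def)
  note sc = semilattice_of_groups_sinv_commute[OF A]
  have 1: "x \<cdot>\<^bsub>A\<^esub> (e \<cdot>\<^bsub>A\<^esub> sinv A x) = e \<cdot>\<^bsub>A\<^esub> (x \<cdot>\<^bsub>A\<^esub> sinv A x)"
  proof -
    have "e \<cdot>\<^bsub>A\<^esub> (sinv A x \<cdot>\<^bsub>A\<^esub> (x \<cdot>\<^bsub>A\<^esub> e)) = x \<cdot>\<^bsub>A\<^esub> (e \<cdot>\<^bsub>A\<^esub> sinv A x)"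
      using sc[of "e \<cdot>\<^bsub>A\<^esub> sinv A x"] x e by simp
    moreover have "sinv A x \<cdot>\<^bsub>A\<^esub> (x \<cdot>\<^bsub>A\<^esub> e) = e \<cdot>\<^bsub>A\<^esub> (sinv A x \<cdot>\<^bsub>A\<^esub> x)"
      using idem_commute[of "sinv A x \<cdot>\<^bsub>A\<^esub> x" e] x e by simp
    ultimately show ?thesis using sc[OF x] x e by simp
  qed
  have "x \<cdot>\<^bsub>A\<^esub> e = (x \<cdot>\<^bsub>A\<^esub> (e \<cdot>\<^bsub>A\<^esub> sinv A x)) \<cdot>\<^bsub>A\<^esub> x" using mult_idem_conv[OF x e] .
  also have "\<dots> = e \<cdot>\<^bsub>A\<^esub> x" unfolding 1 using x e by simp
  finally show ?thesis .
qed

text \<open>The definition gives commutation only inside one component. For arbitrary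
  \<open>x\<close> and \<open>y\<close>, multiplication by the product \<open>e\<close> of their
  range idempotents moves both into the component of \<open>e\<close>; since idempotents are
  central, \<open>e\<close> can be pulled out and is then absorbed by both \<open>x y\<close> and
  \<open>y x\<close>.\<close>

lemma semilattice_of_abelian_groups_comm:
  assumes "semilattice_of_abelian_groups A"
  shows "comm_inverse_semigroup A"
proof -
  have A: "semilattice_of_groups A" using assms by (simp add: semilattice_of_abelian_groups_def)
  interpret inverse_semigroup A using A by (simp add: semilattice_of_groups_def)
  note cent = semilattice_of_groups_idem_central[OF A]
  show ?thesis
  proof
    fix x y assume x: "x \<in> carrier A" and y: "y \<in> carrier A"
    define e where "e = ran_idem A x \<cdot>\<^bsub>A\<^esub> ran_idem A y"
    have e: "e \<in> idems A" using x y by (simp add: e_def)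
    have comp: "e \<cdot>\<^bsub>A\<^esub> z \<in> component A e" if z: "z \<in> carrier A" "e \<cdot>\<^bsub>A\<^esub> ran_idem A z = e" for z
    proof -
      have "(e \<cdot>\<^bsub>A\<^esub> z) \<cdot>\<^bsub>A\<^esub> sinv A (e \<cdot>\<^bsub>A\<^esub> z) = e \<cdot>\<^bsub>A\<^esub> (ran_idem A z \<cdot>\<^bsub>A\<^esub> e)"
        using e z(1) by (simp add: ran_idem_def)
      also have "\<dots> = e" using e z(1) z(2) by (simp flip: assoc)
      finally show ?thesis
        using semilattice_of_groups_sinv_commute[OF A, of "e \<cdot>\<^bsub>A\<^esub> z"] e z(1)
        by (simp add: component_def del: sinv_mult)
    qed
    have "e \<cdot>\<^bsub>A\<^esub> ran_idem A x = e" "e \<cdot>\<^bsub>A\<^esub> ran_idem A y = e"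
      using x y by (simp_all add: e_def idem_commute[of "ran_idem A y" "ran_idem A x"])
    then have *: "(e \<cdot>\<^bsub>A\<^esub> x) \<cdot>\<^bsub>A\<^esub> (e \<cdot>\<^bsub>A\<^esub> y) = (e \<cdot>\<^bsub>A\<^esub> y) \<cdot>\<^bsub>A\<^esub> (e \<cdot>\<^bsub>A\<^esub> x)"
      using assms e comp x y by (simp add: semilattice_of_abelian_groups_def del: assoc)
    have ex: "x \<cdot>\<^bsub>A\<^esub> (e \<cdot>\<^bsub>A\<^esub> y) = e \<cdot>\<^bsub>A\<^esub> (x \<cdot>\<^bsub>A\<^esub> y)" and ey: "y \<cdot>\<^bsub>A\<^esub> (e \<cdot>\<^bsub>A\<^esub> x) = e \<cdot>\<^bsub>A\<^esub> (y \<cdot>\<^bsub>A\<^esub> x)"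
      using cent[OF x e] cent[OF y e] x y e by (simp_all flip: assoc)
    have "e \<cdot>\<^bsub>A\<^esub> (x \<cdot>\<^bsub>A\<^esub> y) = e \<cdot>\<^bsub>A\<^esub> (y \<cdot>\<^bsub>A\<^esub> x)"
      using * ex ey x y e by simp
    moreover have "e \<cdot>\<^bsub>A\<^esub> (u \<cdot>\<^bsub>A\<^esub> v) = u \<cdot>\<^bsub>A\<^esub> v"
      if u: "u \<in> carrier A" and v: "v \<in> carrier A"
        and uv: "e = ran_idem A u \<cdot>\<^bsub>A\<^esub> ran_idem A v" for u v
    proof -
      have "ran_idem A v \<cdot>\<^bsub>A\<^esub> (u \<cdot>\<^bsub>A\<^esub> v) = u \<cdot>\<^bsub>A\<^esub> (ran_idem A v \<cdot>\<^bsub>A\<^esub> v)"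
        using cent[OF u ran_idem_idem[OF v]] u v assoc[of "ran_idem A v" u v] assoc[of u "ran_idem A v" v]
        by (simp del: assoc)
      also have "\<dots> = u \<cdot>\<^bsub>A\<^esub> v" using v by simp
      finally have "e \<cdot>\<^bsub>A\<^esub> (u \<cdot>\<^bsub>A\<^esub> v) = ran_idem A u \<cdot>\<^bsub>A\<^esub> (u \<cdot>\<^bsub>A\<^esub> v)" using u v uv by simp
      also have "\<dots> = u \<cdot>\<^bsub>A\<^esub> v"
        using u v assoc[of "ran_idem A u" u v] by (simp del: assoc)
      finally show ?thesis .
    qed
    moreover have "e = ran_idem A y \<cdot>\<^bsub>A\<^esub> ran_idem A x"
      using x y idem_commute by (simp add: e_def)
    ultimately show "x \<cdot>\<^bsub>A\<^esub> y = y \<cdot>\<^bsub>A\<^esub> x" using x y by (metis e_def)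
  qed
qed

section \<open>Words acting from the right\<close>

lemma words_Nil [simp]: "[] \<in> words X"
  by (simp add: words_def)

lemma words_Cons [simp]: "l # w \<in> words X \<longleftrightarrow> set_letter l \<subseteq> X \<and> w \<in> words X"
  by (auto simp: words_def)

lemma words_append [simp]: "u @ v \<in> words X \<longleftrightarrow> u \<in> words X \<and> v \<in> words X"
  by (auto simp: words_def)

lemma words_reduce_closed [simp]: "w \<in> words X \<Longrightarrow> reduce w \<in> words X"
  by (rule words_reduce)

section \<open>Formal inverses and free reduction\<close>

definition inv_word :: "'x letter list \<Rightarrow> 'x letter list" where
  "inv_word w = map letter_inv (rev w)"

lemma inv_word_simps [simp]:
  "inv_word [] = []" "inv_word (l # w) = inv_word w @ [letter_inv l]"
  "inv_word (u @ v) = inv_word v @ inv_word u" "inv_word (inv_word w) = w"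
  by (simp_all add: inv_word_def rev_map comp_def)

lemma words_inv_word [simp]: "inv_word w \<in> words X \<longleftrightarrow> w \<in> words X"
  by (auto simp: words_def inv_word_def)

lemma reduce_inv_word_left [simp]: "reduce (inv_word w @ w) = []"
  using reduce_inv[of w] by (simp add: inv_word_def)

lemma reduce_inv_word_right [simp]: "reduce (w @ inv_word w) = []"
  using reduce_inv_word_left[of "inv_word w"] by simp

lemma reduce_Nil [simp]: "reduce [] = []"
  by (simp add: reduce_def)

lemma reduce_Cons: "reduce (l # w) = cancel_Cons l (reduce w)"
  by (simp add: reduce_def)

lemma reduce_reduce_middle: "reduce (u @ reduce v @ w) = reduce (u @ v @ w)"
  by (metis reduce_append_left reduce_append_right)

lemma reduce_reduce [simp]: "reduce (reduce w) = reduce w"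
  by (simp add: reduce_reduced)

lemma carrier_FG: "w \<in> carrier (FG X) \<longleftrightarrow> w \<in> words X \<and> reduced w"
  by (auto simp: FG_def)

lemma mult_FG: "u \<otimes>\<^bsub>FG X\<^esub> v = reduce (u @ v)"
  by (simp add: FG_def)

text \<open>Appending \<open>u @ inv_word u\<close>, which reduces to nothing, to
  \<open>inv_word (reduce u)\<close> lets the latter cancel against \<open>u\<close>.\<close>

lemma reduce_inv_word_reduce: "reduce (v @ inv_word (reduce u)) = reduce (v @ inv_word u)"
proof -
  have "reduce (inv_word (reduce u)) = reduce (inv_word (reduce u) @ reduce (u @ inv_word u))"
    by (simp only: reduce_inv_word_right append_Nil2)
  also have "\<dots> = reduce (inv_word (reduce u) @ reduce u @ inv_word u)"
    by (simp only: reduce_append_right reduce_reduce_middle)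
  also have "\<dots> = reduce (reduce (inv_word (reduce u) @ reduce u) @ inv_word u)"
    by (simp only: reduce_append_left append_assoc)
  also have "\<dots> = reduce (inv_word u)" by simp
  finally show ?thesis by (metis reduce_append_right)
qed

text \<open>In a group, \<open>u v u = u\<close> alone forces \<open>v = u^-1\<close>. It serves the
  word coordinate in the uniqueness of inverses in \<open>ext_S\<close> and \<open>ext_N\<close>,
  where only such semigroup equations are given.\<close>

lemma reduce_inverse_unique:
  assumes "reduced v" and red: "reduce (reduce (u @ v) @ u) = u"
  shows "v = reduce (inv_word u)"
proof -
  have "v = reduce (reduce (inv_word u @ u) @ v @ reduce (u @ inv_word u))"
    using assms by (simp add: reduce_reduced)
  also have "\<dots> = reduce (inv_word u @ (u @ v @ u) @ inv_word u)"
    unfolding reduce_append_left by (metis append_assoc reduce_append_right)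
  also have "\<dots> = reduce (inv_word u @ u @ inv_word u)"
    using red by (metis append_assoc reduce_append_left reduce_reduce_middle)
  also have "\<dots> = reduce (inv_word u)"
    by (metis append_Nil append_assoc reduce_append_left reduce_inv_word_left)
  finally show ?thesis .
qed

lemma reduce_square_Nil:
  assumes "reduced u" "reduce (u @ u) = u" shows "u = []"
proof -
  have "u = reduce (reduce (inv_word u @ u) @ u)" using assms by (simp add: reduce_reduced)
  also have "\<dots> = reduce (inv_word u @ reduce (u @ u))"
    by (simp only: reduce_append_left reduce_append_right append_assoc)
  also have "\<dots> = []" using assms by simp
  finally show ?thesis .
qed

lemma idems_adjoin_one: "idems (adjoin_one G) = insert None (Some ` idems G)"
  by (auto simp: idems_def adjoin_one_def)

context inverse_semigroup
begin

lemma letter_val_closed [simp]: "set_letter l \<subseteq> carrier G \<Longrightarrow> letter_val G l \<in> carrier G"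
  by (cases l) auto

lemma letter_val_inv [simp]:
  "set_letter l \<subseteq> carrier G \<Longrightarrow> letter_val G (letter_inv l) = sinv G (letter_val G l)"
  by (cases l) auto

text \<open>Right multiplication by the value of a word in \<open>T^1\<close>. Starting from an
  element of \<open>T\<close> makes the empty word act as the identity, so no identity has to be
  adjoined in the computations.\<close>

primrec act :: "'a \<Rightarrow> 'a letter list \<Rightarrow> 'a" where
  "act x [] = x"
| "act x (l # w) = act (x \<cdot> letter_val G l) w"

lemma act_closed [simp]: "\<lbrakk>x \<in> carrier G; w \<in> words (carrier G)\<rbrakk> \<Longrightarrow> act x w \<in> carrier G"
  by (induction w arbitrary: x) auto

lemma act_append: "act x (u @ v) = act (act x u) v"
  by (induction u arbitrary: x) auto

lemma act_mult:
  "\<lbrakk>x \<in> carrier G; y \<in> carrier G; w \<in> words (carrier G)\<rbrakk> \<Longrightarrow> act (x \<cdot> y) w = x \<cdot> act y w"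
  by (induction w arbitrary: y) auto

lemma act_mono: "\<lbrakk>nat_le G x y; w \<in> words (carrier G)\<rbrakk> \<Longrightarrow> nat_le G (act x w) (act y w)"
proof (induction w arbitrary: x y)
  case (Cons l w)
  then have "nat_le G (x \<cdot> letter_val G l) (y \<cdot> letter_val G l)"
    by (intro nat_le_mult) simp_all
  with Cons show ?case by simp
qed simp

text \<open>A pair \<open>l l^-1\<close> contributes an idempotent factor; removing it can only
  enlarge the value.\<close>

lemma act_cancel_Cons_le:
  assumes "x \<in> carrier G" "l # w \<in> words (carrier G)"
  shows "nat_le G (act x (l # w)) (act x (cancel_Cons l w))"
proof (cases "\<exists>v. w = letter_inv l # v")
  case True
  then obtain v where v: "w = letter_inv l # v" by blast
  with assms nat_le_mult_idem[of x "letter_val G l \<cdot> sinv G (letter_val G l)"]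
  show ?thesis by (auto intro: act_mono)
next
  case False
  then have "cancel_Cons l w = l # w" by (cases w) auto
  with assms show ?thesis by simp
qed

lemma act_reduce_le:
  "\<lbrakk>x \<in> carrier G; w \<in> words (carrier G)\<rbrakk> \<Longrightarrow> nat_le G (act x w) (act x (reduce w))"
proof (induction w arbitrary: x)
  case (Cons l w)
  have "nat_le G (act x (l # w)) (act x (l # reduce w))"
    using Cons by simp
  also have "nat_le G \<dots> (act x (cancel_Cons l (reduce w)))"
    using Cons by (intro act_cancel_Cons_le) simp_all
  finally (nat_le_trans) show ?case by (simp add: reduce_Cons)
qed simp

text \<open>The relation \<open>t \<le> \<nu>(w)\<close>, see \<open>nat_le_nu_iff\<close>. With the
  quantified idempotent as starting point, the empty word needs no separate clause: there it says
  that \<open>t\<close> is idempotent, that is \<open>t \<le> 1\<close>.\<close>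

definition below :: "'a \<Rightarrow> 'a letter list \<Rightarrow> bool" where
  "below t w \<longleftrightarrow> (\<exists>e \<in> idems G. t = act e w)"

lemma below_nat_le:
  assumes "nat_le G s t" "below t w" "w \<in> words (carrier G)" shows "below s w"
proof -
  obtain f e where *: "f \<in> idems G" "s = f \<cdot> t" "e \<in> idems G" "t = act e w"
    using assms(1,2) by (auto simp: below_def nat_le_def)
  then have "s = act (f \<cdot> e) w" using assms(3) by (simp add: act_mult)
  with * show ?thesis unfolding below_def by (intro bexI[of _ "f \<cdot> e"]) simp_all
qed

lemma below_reduce:
  assumes "below t w" "w \<in> words (carrier G)" shows "below t (reduce w)"
proof -
  obtain e where e: "e \<in> idems G" "t = act e w" using assms by (auto simp: below_def)
  then have "below (act e (reduce w)) (reduce w)" by (auto simp: below_def)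
  with e assms act_reduce_le[of e w] show ?thesis by (auto intro: below_nat_le)
qed

text \<open>If \<open>t = act e w\<close>, then \<open>e\<close> fixes \<open>t\<close>, hence the
  range idempotent of \<open>t\<close> lies below \<open>e\<close>; multiplying
  \<open>act e w\<close> by it from the left gives the claim.\<close>

lemma act_ran_idem:
  assumes "below t w" "w \<in> words (carrier G)" shows "act (ran_idem G t) w = t"
proof -
  obtain e where e: "e \<in> idems G" "t = act e w" using assms by (auto simp: below_def)
  then have t: "t \<in> carrier G" using assms by simp
  have et: "e \<cdot> t = t" using e assms act_mult[of e e w] by simp
  have "t = ran_idem G t \<cdot> act e w" using t e by simp
  also have "\<dots> = act (ran_idem G t \<cdot> e) w" using e t assms by (simp add: act_mult)
  also have "ran_idem G t \<cdot> e = e \<cdot> ran_idem G t" using e t by (simp add: idem_commute)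
  also have "\<dots> = ran_idem G t"
    using et e t assoc[of e t "sinv G t"] by (simp add: ran_idem_def del: assoc)
  finally show ?thesis ..
qed

text \<open>The form in which \<open>e \<le> \<nu>(w)\<close> enters every range computation:
  reading \<open>w\<close> from \<open>e\<close> returns to \<open>e\<close>.\<close>

lemma act_idem: "\<lbrakk>e \<in> idems G; below e w; w \<in> words (carrier G)\<rbrakk> \<Longrightarrow> act e w = e"
  using act_ran_idem[of e w] by simp

text \<open>With \<open>s = act e u\<close> and \<open>t = act f v\<close>, the idempotent
  \<open>f\<close> is carried to the left across \<open>s\<close> as \<open>s f s^-1\<close>, so
  that reading \<open>u @ v\<close> starts from a single idempotent.\<close>

lemma below_append:
  assumes "below s u" "below t v" and u: "u \<in> words (carrier G)" and v: "v \<in> words (carrier G)"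
  shows "below (s \<cdot> t) (u @ v)"
proof -
  obtain e f where *: "e \<in> idems G" "s = act e u" "f \<in> idems G" "t = act f v"
    using assms by (auto simp: below_def)
  then have s: "s \<in> carrier G" using u by simp
  have "s \<cdot> t = act (s \<cdot> f) v" using * s v by (simp add: act_mult)
  also have "s \<cdot> f = (s \<cdot> (f \<cdot> sinv G s)) \<cdot> s" using s * by (intro mult_idem_conv) auto
  also have "\<dots> = act ((s \<cdot> (f \<cdot> sinv G s)) \<cdot> e) u"
    using act_mult[of "s \<cdot> (f \<cdot> sinv G s)" e u] s * u by simp
  finally have "s \<cdot> t = act ((s \<cdot> (f \<cdot> sinv G s)) \<cdot> e) (u @ v)" by (simp add: act_append)
  moreover have "(s \<cdot> (f \<cdot> sinv G s)) \<cdot> e \<in> idems G"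
    using s * by (intro idem_mult_idem conj_idem) auto
  ultimately show ?thesis by (auto simp: below_def)
qed

lemma below_letter:
  "set_letter l \<subseteq> carrier G \<Longrightarrow> below (letter_val G l) [l]"
  unfolding below_def by (rule bexI[of _ "ran_idem G (letter_val G l)"]) simp_all

lemma below_Nil [simp]: "below t [] \<longleftrightarrow> t \<in> idems G"
  by (simp add: below_def)

lemma below_inv_word:
  "\<lbrakk>below t w; w \<in> words (carrier G)\<rbrakk> \<Longrightarrow> below (sinv G t) (inv_word w)"
proof (induction w arbitrary: t rule: rev_induct)
  case (snoc l w)
  then obtain e where e: "e \<in> idems G" "t = act e w \<cdot> letter_val G l"
    by (auto simp: below_def act_append)
  have w: "w \<in> words (carrier G)" "set_letter l \<subseteq> carrier G" using snoc.prems by auto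
  have "below (sinv G (act e w)) (inv_word w)" using snoc.IH e w by (auto simp: below_def)
  then have "below (letter_val G (letter_inv l) \<cdot> sinv G (act e w)) ([letter_inv l] @ inv_word w)"
    using w by (intro below_append below_letter) auto
  then show ?case using e w by simp
qed simp

lemma below_conj:
  assumes "below t u" "below e w" "u \<in> words (carrier G)" "w \<in> words (carrier G)"
  shows "below (t \<cdot> e \<cdot> sinv G t) (u @ w @ inv_word u)"
  using below_append[OF below_append[OF assms] below_inv_word[OF assms(1,3)]] assms by simp

lemma word_val_Cons: "word_val G (l # w) = act (letter_val G l) w"
proof -
  have "foldl (\<lambda>a b. a \<cdot> b) x (map (letter_val G) w) = act x w" for x
    by (induction w arbitrary: x) auto
  then show ?thesis by (simp add: word_val_def)
qed

lemma nat_le_nu_iff: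
  assumes "t \<in> carrier G" "w \<in> words (carrier G)"
  shows "nat_le (adjoin_one G) (Some t) (nu G w) \<longleftrightarrow> below t w"
proof (cases w)
  case Nil
  with assms show ?thesis
    by (auto simp: nat_le_def nu_def idems_adjoin_one) (auto simp: adjoin_one_def)
next
  case (Cons l v)
  then have lv: "set_letter l \<subseteq> carrier G" "v \<in> words (carrier G)" using assms by auto
  have act: "act e w = e \<cdot> word_val G w" if "e \<in> idems G" for e
    using that lv by (simp add: Cons word_val_Cons act_mult)
  have wv: "word_val G w \<in> carrier G" using lv by (simp add: Cons word_val_Cons)
  \<comment> \<open>The adjoined identity is itself an idempotent of \<open>T^1\<close> and produces
    the first disjunct. The second one covers it, since every element is fixed by its range
    idempotent.\<close>
  have "nat_le (adjoin_one G) (Some t) (nu G w) \<longleftrightarrow>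
      t = word_val G w \<or> (\<exists>e \<in> idems G. t = e \<cdot> word_val G w)"
    using Cons wv assms
    by (auto simp: nat_le_def nu_def idems_adjoin_one) (auto simp: adjoin_one_def)
  also have "\<dots> \<longleftrightarrow> (\<exists>e \<in> idems G. t = e \<cdot> word_val G w)"
    using wv ran_idem_mult_self[of "word_val G w"] ran_idem_idem[of "word_val G w"] by metis
  also have "\<dots> \<longleftrightarrow> below t w" by (auto simp: below_def act)
  finally show ?thesis .
qed

section \<open>The inverse semigroup \<open>S\<close>\<close>

lemma carrier_ext_S:
  "(t, u) \<in> carrier (ext_S G) \<longleftrightarrow>
    t \<in> carrier G \<and> u \<in> words (carrier G) \<and> reduced u \<and> below t u"
  by (auto simp: ext_S_def carrier_FG nat_le_nu_iff)

lemma mult_ext_S [simp]: "(t, u) \<cdot>\<^bsub>ext_S G\<^esub> (t', u') = (t \<cdot> t', reduce (u @ u'))"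
  by (simp add: ext_S_def mult_FG)

text \<open>As an equivalence this yields existence, uniqueness and the value of inverses at once,
  before \<open>ext_S G\<close> is known to be an inverse semigroup.\<close>

lemma is_inverse_of_ext_S:
  assumes "(t, u) \<in> carrier (ext_S G)"
  shows "is_inverse_of (ext_S G) (t, u) y \<longleftrightarrow> y = (sinv G t, reduce (inv_word u))"
proof
  have tu: "t \<in> carrier G" "u \<in> words (carrier G)" "reduced u" "below t u"
    using assms by (auto simp: carrier_ext_S)
  {
    assume "y = (sinv G t, reduce (inv_word u))"
    moreover have "reduce (reduce (u @ reduce (inv_word u)) @ u) = u"
      using tu by (simp add: reduce_append_right reduce_reduced)
    moreover have "reduce (reduce (reduce (inv_word u) @ u) @ reduce (inv_word u)) = reduce (inv_word u)"
      by (simp add: reduce_append_left)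
    ultimately show "is_inverse_of (ext_S G) (t, u) y"
      using tu by (simp add: is_inverse_of_def carrier_ext_S below_inv_word below_reduce)
  }
  {
    assume y: "is_inverse_of (ext_S G) (t, u) y"
    obtain s v where sv: "y = (s, v)" by (cases y)
    have s: "s \<in> carrier G" "v \<in> words (carrier G)" "reduced v"
      and inv: "is_inverse_of G t s" and red: "reduce (reduce (u @ v) @ u) = u"
      using y tu by (auto simp: is_inverse_of_def sv carrier_ext_S)
    show "y = (sinv G t, reduce (inv_word u))"
      using sv inv sinv_eqI[OF tu(1)] reduce_inverse_unique[OF s(3) red] by simp
  }
qed

lemma inverse_semigroup_ext_S: "inverse_semigroup (ext_S G)"
proof
  fix x y assume "x \<in> carrier (ext_S G)" "y \<in> carrier (ext_S G)"
  then show "x \<cdot>\<^bsub>ext_S G\<^esub> y \<in> carrier (ext_S G)"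
    by (cases x; cases y) (auto simp: carrier_ext_S intro: below_reduce below_append)
next
  fix x y z assume "x \<in> carrier (ext_S G)" "y \<in> carrier (ext_S G)" "z \<in> carrier (ext_S G)"
  then show "x \<cdot>\<^bsub>ext_S G\<^esub> y \<cdot>\<^bsub>ext_S G\<^esub> z = x \<cdot>\<^bsub>ext_S G\<^esub> (y \<cdot>\<^bsub>ext_S G\<^esub> z)"
    by (cases x; cases y; cases z)
      (auto simp: carrier_ext_S reduce_append_left reduce_append_right)
next
  fix x assume "x \<in> carrier (ext_S G)"
  then show "\<exists>!y. is_inverse_of (ext_S G) x y"
    by (cases x) (auto simp: is_inverse_of_ext_S)
qed

lemma sinv_ext_S: "(t, u) \<in> carrier (ext_S G) \<Longrightarrow>
    sinv (ext_S G) (t, u) = (sinv G t, reduce (inv_word u))"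
  by (simp add: sinv_def[of "ext_S G"] is_inverse_of_ext_S)

lemma idems_ext_S: "idems (ext_S G) = idems G \<times> {[]}"
proof (intro equalityI subsetI)
  fix x assume "x \<in> idems (ext_S G)"
  then obtain t u where "x = (t, u)" "(t, u) \<in> carrier (ext_S G)" "t \<cdot> t = t" "reduce (u @ u) = u"
    by (cases x) (auto simp: idems_def[of "ext_S G"])
  then show "x \<in> idems G \<times> {[]}"
    using reduce_square_Nil[of u] by (auto simp: carrier_ext_S intro: idemsI)
qed (auto simp: idems_def[of "ext_S G"] carrier_ext_S)

lemma ran_idem_ext_S:
  "(t, u) \<in> carrier (ext_S G) \<Longrightarrow> ran_idem (ext_S G) (t, u) = (ran_idem G t, [])"
  by (simp add: ran_idem_def[of "ext_S G"] sinv_ext_S ran_idem_def[of G] reduce_append_right)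

end

section \<open>Twisting by an order-preserving cocycle\<close>

context comm_inverse_semigroup
begin

lemma mult_sinv_le_idem: "nat_le G y x \<Longrightarrow> x \<cdot> sinv G y \<in> idems G"
  using idem_mult_idem[of "x \<cdot> sinv G x"] by (auto elim!: nat_leE simp del: idem_mult_idem)

lemma nat_le_idem:
  assumes "nat_le G x e" "e \<in> idems G" shows "x \<in> idems G"
  using assms by (auto elim!: nat_leE)

lemma ran_idem_eq: "\<lbrakk>x \<in> carrier G; ran_idem G x = e\<rbrakk> \<Longrightarrow> e \<cdot> x = x"
  by auto

lemma ran_idem_eq_left:
  "\<lbrakk>x \<in> carrier G; y \<in> carrier G; ran_idem G x = e\<rbrakk> \<Longrightarrow> e \<cdot> (x \<cdot> y) = x \<cdot> y"
  by (metis assoc ran_idem_eq ran_idem_idem idems_carrier)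

end

locale ordered_cocycle =
  fixes T :: "'t sgrp" and A :: "'a sgrp"
    and \<theta> :: "'t \<Rightarrow> 'a" and \<eta> :: "'t \<Rightarrow> 'a \<Rightarrow> 'a" and c :: "'t list \<Rightarrow> 'a"
  assumes module: "T_module T A \<theta> \<eta>"
    and cocycle: "c \<in> order_preserving_cocycles T A \<theta> \<eta> 3"
    and normalized: "normalized3 T \<theta> c"
begin

sublocale T: inverse_semigroup T
  using module by (simp add: T_module_def)

sublocale A: comm_inverse_semigroup A
  using module by (simp add: T_module_def semilattice_of_abelian_groups_comm)

abbreviation tmult (infixl "\<odot>" 70) where "x \<odot> y \<equiv> x \<cdot>\<^bsub>T\<^esub> y"
abbreviation amult (infixl "\<star>" 70) where "a \<star> b \<equiv> a \<cdot>\<^bsub>A\<^esub> b"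
abbreviation rho ("\<rho>") where "\<rho> t \<equiv> \<theta> (ran_idem T t)"

section \<open>Rules for the module structure and for cocycle values\<close>

lemma theta_iso: "\<theta> \<in> sg_iso (idem_sgrp T) (idem_sgrp A)"
  using module by (simp add: T_module_def)

lemma theta_idem [simp]: "e \<in> idems T \<Longrightarrow> \<theta> e \<in> idems A"
  using theta_iso by (auto simp: sg_iso_def sg_hom_def idem_sgrp_def)

lemma theta_mult: "\<lbrakk>e \<in> idems T; f \<in> idems T\<rbrakk> \<Longrightarrow> \<theta> e \<star> \<theta> f = \<theta> (e \<odot> f)"
  using theta_iso by (auto simp: sg_iso_def sg_hom_def idem_sgrp_def)

lemma bij_theta: "bij_betw \<theta> (idems T) (idems A)"
  using theta_iso by (auto simp: sg_iso_def idem_sgrp_def)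

lemma eta_hom: "t \<in> carrier T \<Longrightarrow> \<eta> t \<in> sg_hom A A"
  using module by (auto simp: T_module_def sg_hom_def[of T] rel_End_def)

lemma eta_closed [simp]: "\<lbrakk>t \<in> carrier T; a \<in> carrier A\<rbrakk> \<Longrightarrow> \<eta> t a \<in> carrier A"
  by (rule sg_hom_closed[OF eta_hom])

lemma eta_mult: "\<lbrakk>t \<in> carrier T; a \<in> carrier A; b \<in> carrier A\<rbrakk> \<Longrightarrow> \<eta> t (a \<star> b) = \<eta> t a \<star> \<eta> t b"
  by (rule sg_hom_mult[OF eta_hom])

lemma eta_comp: "\<lbrakk>s \<in> carrier T; t \<in> carrier T; a \<in> carrier A\<rbrakk> \<Longrightarrow> \<eta> s (\<eta> t a) = \<eta> (s \<odot> t) a"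
  using module by (auto simp: T_module_def sg_hom_def[of T] rel_End_def compose_def)

lemma eta_idem: "\<lbrakk>e \<in> idems T; a \<in> carrier A\<rbrakk> \<Longrightarrow> \<eta> e a = \<theta> e \<star> a"
  using module by (auto simp: T_module_def)

lemma eta_theta: "\<lbrakk>t \<in> carrier T; e \<in> idems T\<rbrakk> \<Longrightarrow> \<eta> t (\<theta> e) = \<theta> (t \<odot> (e \<odot> sinv T t))"
  using module by (auto simp: T_module_def)

lemma eta_sinv: "\<lbrakk>t \<in> carrier T; a \<in> carrier A\<rbrakk> \<Longrightarrow> \<eta> t (sinv A a) = sinv A (\<eta> t a)"
  using sg_hom_sinv[OF A.inverse_semigroup_axioms A.inverse_semigroup_axioms eta_hom] .

lemma ran_idem_eta: "\<lbrakk>t \<in> carrier T; a \<in> carrier A\<rbrakk> \<Longrightarrow> ran_idem A (\<eta> t a) = \<eta> t (ran_idem A a)"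
  by (simp add: ran_idem_def eta_mult eta_sinv)

lemma eta_rho: "\<lbrakk>s \<in> carrier T; t \<in> carrier T\<rbrakk> \<Longrightarrow> \<eta> s (\<rho> t) = \<rho> (s \<odot> t)"
  by (simp add: eta_theta T.ran_idem_mult)

lemma rho_absorb:
  "\<lbrakk>x \<in> carrier T; y \<in> carrier T\<rbrakk> \<Longrightarrow> \<rho> x \<star> \<rho> (x \<odot> y) = \<rho> (x \<odot> y)"
  by (simp add: theta_mult) (simp add: ran_idem_def)

lemma cochain:
  assumes "s \<in> carrier T" "t \<in> carrier T" "x \<in> carrier T"
  shows "c [s, t, x] \<in> carrier A" "ran_idem A (c [s, t, x]) = \<rho> (s \<odot> (t \<odot> x))"
proof -
  have "c [s, t, x] \<in> component A (\<theta> (ran_idem T (sprod T [s, t, x])))"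
    using cocycle assms
    by (auto simp: order_preserving_cocycles_def order_preserving_cochains_def cochains_def tuples_def
        simp del: sprod.simps)
  with assms show "c [s, t, x] \<in> carrier A" "ran_idem A (c [s, t, x]) = \<rho> (s \<odot> (t \<odot> x))"
    by (simp_all add: A.component_iff)
qed

declare cochain(1) [simp]

lemma cochain_mono:
  assumes "nat_le T s s'" "nat_le T t t'" "nat_le T x x'"
  shows "nat_le A (c [s, t, x]) (c [s', t', x'])"
  using cocycle assms T.nat_le_carrier[OF assms(1)] T.nat_le_carrier[OF assms(2)]
    T.nat_le_carrier[OF assms(3)]
  by (auto simp: order_preserving_cocycles_def order_preserving_cochains_def tuples_def)

lemma cocycle_identity:
  assumes "s \<in> carrier T" "t \<in> carrier T" "x \<in> carrier T" "y \<in> carrier T"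
  shows "\<eta> s (c [t, x, y]) \<star> c [s, t \<odot> x, y] \<star> c [s, t, x] = c [s \<odot> t, x, y] \<star> c [s, t, x \<odot> y]"
proof -
  let ?a = "\<eta> s (c [t, x, y])" and ?b = "c [s \<odot> t, x, y]" and ?d = "c [s, t \<odot> x, y]"
    and ?e = "c [s, t, x \<odot> y]" and ?f = "c [s, t, x]" and ?r = "\<rho> (s \<odot> (t \<odot> (x \<odot> y)))"
  have "coboundary T A \<eta> 3 c [s, t, x, y] = \<theta> (ran_idem T (sprod T [s, t, x, y]))"
    using cocycle assms by (auto simp: order_preserving_cocycles_def tuples_def simp del: sprod.simps)
  then have *: "?a \<star> (sinv A ?b \<star> (?d \<star> (sinv A ?e \<star> ?f))) = ?r"
    using assms by (simp add: coboundary_def upt_rec alt_def)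
  have c: "?a \<in> carrier A" "?b \<in> carrier A" "?d \<in> carrier A" "?e \<in> carrier A" "?f \<in> carrier A"
    using assms by simp_all
  have r: "?r \<in> idems A" "?r \<in> carrier A" using assms by simp_all
  have ran: "ran_idem A ?a = ?r" "ran_idem A ?b = ?r" "ran_idem A ?e = ?r"
    using assms by (simp_all add: cochain ran_idem_eta eta_rho)
  have "?a \<star> ?d \<star> ?f = ran_idem A ?b \<star> (ran_idem A ?e \<star> (?a \<star> ?d \<star> ?f))"
    unfolding ran using c r A.ran_idem_eq_left[OF c(1) _ ran(1)] by simp
  also have "\<dots> = ?b \<star> ?e \<star> (?a \<star> (sinv A ?b \<star> (?d \<star> (sinv A ?e \<star> ?f))))"
    unfolding ran_idem_def[of A] using c by (simp add: A.ac)
  also have "\<dots> = ?b \<star> ?e" unfolding *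
    using c r A.ran_idem_eq_left[OF c(2) c(4) ran(2)] by (simp add: A.ac)
  finally show ?thesis .
qed

text \<open>Normalization speaks only of the middle argument \<open>e x\<close>. Order preservation
  makes that value comparable with \<open>c [e, x, y]\<close>, and both have the same range
  idempotent. The next two lemmas remove the restriction on the other positions in the same
  way.\<close>

lemma cochain_idem_left:
  assumes "e \<in> idems T" "x \<in> carrier T" "y \<in> carrier T"
  shows "c [e, x, y] = \<rho> (e \<odot> (x \<odot> y))"
proof -
  have "c [e, e \<odot> x, y] = c [e, x, y]"
    using assms by (intro A.nat_le_ran_eq[OF cochain_mono]) (simp_all add: cochain(2) T.nat_le_idem_mult)
  then show ?thesis using normalized assms by (simp add: normalized3_def)
qed

lemma cochain_idem_middle:
  assumes "e \<in> idems T" "x \<in> carrier T" "y \<in> carrier T"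
  shows "c [x, e, y] = \<rho> (x \<odot> (e \<odot> y))"
proof -
  have "c [x \<odot> e, e, e \<odot> y] = c [x, e, y]"
    using assms by (intro A.nat_le_ran_eq[OF cochain_mono]) (simp_all add: cochain(2) T.nat_le_idem_mult T.nat_le_mult_idem)
  then show ?thesis using normalized assms by (simp add: normalized3_def)
qed

lemma cochain_idem_right:
  assumes "e \<in> idems T" "x \<in> carrier T" "y \<in> carrier T"
  shows "c [x, y, e] = \<rho> (x \<odot> (y \<odot> e))"
proof -
  have "c [x, y \<odot> e, e] = c [x, y, e]"
    using assms by (intro A.nat_le_ran_eq[OF cochain_mono]) (simp_all add: cochain(2) T.nat_le_mult_idem)
  then show ?thesis using normalized assms by (simp add: normalized3_def)
qed

text \<open>Reading \<open>Neg y\<close> from \<open>x\<close> leads to \<open>x y^-1\<close>, and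
  its factor is inverse to that of reading \<open>Pos y\<close> from \<open>x y^-1\<close>.\<close>

definition letter_twist :: "'t \<Rightarrow> 't \<Rightarrow> 't letter \<Rightarrow> 'a" where
  "letter_twist t x l =
    (case l of Pos y \<Rightarrow> c [t, x, y] | Neg y \<Rightarrow> sinv A (c [t, x \<odot> sinv T y, y]))"

text \<open>\<open>twist t x w\<close> is the contribution of \<open>w\<close> to \<open>\<xi>\<^sub>t\<close> when reading starts after a prefix with
  value \<open>x\<close>, so \<open>\<xi>\<^sub>t([x]w) = twist t x w\<close>; \<open>x\<close> need not be a letter of the word, and taking an
  idempotent for \<open>x\<close> treats all words, the empty one included, alike.\<close>

primrec twist :: "'t \<Rightarrow> 't \<Rightarrow> 't letter list \<Rightarrow> 'a" where
  "twist t x [] = \<rho> (t \<odot> x)"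
| "twist t x (l # w) = letter_twist t x l \<star> twist t (x \<odot> letter_val T l) w"

lemma letter_twist_simps [simp]:
  "letter_twist t x (Pos y) = c [t, x, y]"
  "letter_twist t x (Neg y) = sinv A (c [t, x \<odot> sinv T y, y])"
  by (simp_all add: letter_twist_def)

lemma letter_twist_closed [simp]:
  "\<lbrakk>t \<in> carrier T; x \<in> carrier T; set_letter l \<subseteq> carrier T\<rbrakk> \<Longrightarrow> letter_twist t x l \<in> carrier A"
  by (cases l) auto

lemma ran_letter_twist:
  "\<lbrakk>t \<in> carrier T; x \<in> carrier T; set_letter l \<subseteq> carrier T\<rbrakk>
    \<Longrightarrow> ran_idem A (letter_twist t x l) = \<rho> (t \<odot> (x \<odot> letter_val T l))"
  by (cases l) (auto simp: cochain ran_idem_def[of T])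

lemma letter_twist_mono:
  "\<lbrakk>t \<in> carrier T; nat_le T x y; set_letter l \<subseteq> carrier T\<rbrakk>
    \<Longrightarrow> nat_le A (letter_twist t x l) (letter_twist t y l)"
  by (cases l) (auto intro!: cochain_mono A.nat_le_sinv T.nat_le_mult)

text \<open>A negative letter followed by its positive one gives an element times its own inverse.
  In the other order the middle arguments are \<open>x\<close> and \<open>x y y^-1\<close>, so order
  preservation is required: the second value lies below the first.\<close>

lemma letter_twist_cancel:
  assumes "t \<in> carrier T" "x \<in> carrier T" "set_letter l \<subseteq> carrier T"
  shows "letter_twist t x l \<star> letter_twist t (x \<odot> letter_val T l) (letter_inv l) \<in> idems A"
proof (cases l)
  case (Pos y)
  then have "nat_le A (c [t, x \<odot> (y \<odot> sinv T y), y]) (c [t, x, y])"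
    using assms by (intro cochain_mono) (auto intro!: T.nat_le_mult_idem)
  with Pos show ?thesis using assms by (simp add: A.mult_sinv_le_idem)
qed (use assms in simp)

lemma twist_closed [simp]:
  "\<lbrakk>t \<in> carrier T; x \<in> carrier T; w \<in> words (carrier T)\<rbrakk> \<Longrightarrow> twist t x w \<in> carrier A"
  by (induction w arbitrary: x) auto

lemma ran_twist:
  "\<lbrakk>t \<in> carrier T; x \<in> carrier T; w \<in> words (carrier T)\<rbrakk>
    \<Longrightarrow> ran_idem A (twist t x w) = \<rho> (t \<odot> T.act x w)"
proof (induction w arbitrary: x)
  case (Cons l w)
  let ?y = "x \<odot> letter_val T l"
  have y: "?y \<in> carrier T" using Cons.prems by simp
  \<comment> \<open>Writing \<open>?y\<close> as \<open>?y (?y^-1 ?y)\<close> exhibits the value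
    reached as a right multiple of \<open>?y\<close>, so its range idempotent lies below that of
    \<open>?y\<close>, also after left multiplication by \<open>t\<close>.\<close>
  have "T.act ?y w = ?y \<odot> T.act (sinv T ?y \<odot> ?y) w"
    using T.act_mult[of ?y "sinv T ?y \<odot> ?y" w] y Cons.prems
    by (simp only: T.mult_sinv_mult) simp
  then have "\<rho> (t \<odot> ?y) \<star> \<rho> (t \<odot> T.act ?y w) = \<rho> (t \<odot> T.act ?y w)"
    using rho_absorb[of "t \<odot> ?y" "T.act (sinv T ?y \<odot> ?y) w"] y Cons.prems by simp
  then show ?case using Cons by (simp add: A.ran_idem_mult_comm ran_letter_twist)
qed simp

lemma twist_absorb:
  assumes "t \<in> carrier T" "x \<in> carrier T" "w \<in> words (carrier T)"
  shows "\<rho> (t \<odot> x) \<star> twist t x w = twist t x w"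
proof -
  have "T.act x w = x \<odot> T.act (sinv T x \<odot> x) w"
    using T.act_mult[of x "sinv T x \<odot> x" w] assms by simp
  then have "\<rho> (t \<odot> x) \<star> \<rho> (t \<odot> T.act x w) = \<rho> (t \<odot> T.act x w)"
    using rho_absorb[of "t \<odot> x" "T.act (sinv T x \<odot> x) w"] assms by simp
  then have "\<rho> (t \<odot> x) \<star> ran_idem A (twist t x w) = ran_idem A (twist t x w)"
    using assms by (simp add: ran_twist)
  then show ?thesis
    using assms A.assoc[of "\<rho> (t \<odot> x)" "ran_idem A (twist t x w)" "twist t x w"]
    by (simp del: A.assoc)
qed

lemma twist_mono:
  "\<lbrakk>t \<in> carrier T; nat_le T x y; w \<in> words (carrier T)\<rbrakk> \<Longrightarrow> nat_le A (twist t x w) (twist t y w)"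
proof (induction w arbitrary: x y)
  case Nil
  then obtain e where e: "e \<in> idems T" "x = e \<odot> y" "y \<in> carrier T" by (auto elim!: T.nat_leE)
  have "ran_idem T (t \<odot> x) = ran_idem T (t \<odot> x) \<odot> ran_idem T (t \<odot> y)"
  proof -
    have "nat_le T (t \<odot> x) (t \<odot> y)" using Nil by (intro T.nat_le_mult) simp_all
    from T.nat_le_ran[OF T.nat_le_ran_idem[OF this]] show ?thesis using Nil e by simp
  qed
  then show ?case using Nil e
    by (intro A.nat_leI[of "\<rho> (t \<odot> x)"]) (simp_all add: theta_mult)
next
  case (Cons l w)
  have "nat_le T (x \<odot> letter_val T l) (y \<odot> letter_val T l)"
    using Cons.prems by (intro T.nat_le_mult) simp_all
  then show ?case using Cons by (auto intro!: A.nat_le_mult letter_twist_mono)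
qed

lemma twist_append:
  "\<lbrakk>t \<in> carrier T; x \<in> carrier T; u \<in> words (carrier T); v \<in> words (carrier T)\<rbrakk>
    \<Longrightarrow> twist t x (u @ v) = twist t x u \<star> twist t (T.act x u) v"
  by (induction u arbitrary: x) (auto simp: twist_absorb)

text \<open>Removing a cancelling pair has two effects, both upwards: an idempotent factor
  disappears, and the remaining word is read from \<open>x\<close> instead of the smaller
  \<open>?y\<close>.\<close>

lemma twist_cancel_Cons_le:
  assumes "t \<in> carrier T" "x \<in> carrier T" "l # w \<in> words (carrier T)"
  shows "nat_le A (twist t x (l # w)) (twist t x (cancel_Cons l w))"
proof (cases "\<exists>v. w = letter_inv l # v")
  case True
  then obtain v where v: "w = letter_inv l # v" by blast
  let ?i = "letter_twist t x l \<star> letter_twist t (x \<odot> letter_val T l) (letter_inv l)"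
  let ?y = "x \<odot> (letter_val T l \<odot> sinv T (letter_val T l))"
  have l: "set_letter l \<subseteq> carrier T" "v \<in> words (carrier T)" using assms v by auto
  have "twist t x (l # w) = ?i \<star> twist t ?y v" using assms v l by simp
  also have "nat_le A \<dots> (twist t ?y v)"
    using assms l by (intro A.nat_le_idem_mult letter_twist_cancel) simp_all
  also have "nat_le A \<dots> (twist t x v)"
    using assms l by (intro twist_mono T.nat_le_mult_idem) simp_all
  finally (A.nat_le_trans) show ?thesis using v by simp
next
  case False
  then have "cancel_Cons l w = l # w" by (cases w) auto
  with assms show ?thesis using twist_closed[of t x "l # w"] by simp
qed

lemma twist_reduce_le:
  "\<lbrakk>t \<in> carrier T; x \<in> carrier T; w \<in> words (carrier T)\<rbrakk>
    \<Longrightarrow> nat_le A (twist t x w) (twist t x (reduce w))"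
proof (induction w arbitrary: x)
  case (Cons l w)
  have "nat_le A (twist t x (l # w)) (twist t x (l # reduce w))"
    using Cons by (auto intro!: A.nat_le_mult)
  also have "nat_le A \<dots> (twist t x (cancel_Cons l (reduce w)))"
    using Cons by (intro twist_cancel_Cons_le) simp_all
  finally (A.nat_le_trans) show ?case by (simp add: reduce_Cons)
qed simp

text \<open>The product is \<open>twist t x (w @ inv_word w)\<close>, which lies below the value at
  the reduced, empty word. That value is idempotent, and so is everything below it.\<close>

lemma twist_inv_word:
  assumes "t \<in> carrier T" "x \<in> carrier T" "w \<in> words (carrier T)"
  shows "twist t x w \<star> twist t (T.act x w) (inv_word w) \<in> idems A"
  by (rule A.nat_le_idem[of _ "\<rho> (t \<odot> x)"])
    (use twist_reduce_le[of t x "w @ inv_word w"] assms in \<open>simp_all add: twist_append\<close>)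

lemma twist_reduce:
  assumes "t \<in> carrier T" "e \<in> idems T" "w \<in> words (carrier T)" "T.act e w = e"
  shows "twist t e (reduce w) = twist t e w"
proof -
  have "T.below e w" unfolding T.below_def using assms by (intro bexI[of _ e]) simp_all
  then have "T.act e (reduce w) = e" using assms by (intro T.act_idem T.below_reduce) auto
  then show ?thesis
    using assms by (intro A.nat_le_ran_eq[OF twist_reduce_le, symmetric]) (simp_all add: ran_twist)
qed

text \<open>Reading \<open>u\<close> from \<open>t e t^-1\<close> leads to \<open>t e\<close>,
  reading \<open>w\<close> stays there, and reading \<open>inv_word u\<close> leads back. The
  factors of \<open>u\<close> and \<open>inv_word u\<close> combine to an idempotent, which gives an
  inequality; both sides have the range idempotent belonging to \<open>s t e\<close>.\<close>

lemma twist_conj: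
  assumes s: "s \<in> carrier T" and t: "t \<in> carrier T" and e: "e \<in> idems T"
    and u: "u \<in> words (carrier T)" "T.below t u" and w: "w \<in> words (carrier T)" "T.below e w"
  shows "twist s (t \<odot> e \<odot> sinv T t) (reduce (u @ w @ inv_word u)) = twist s (t \<odot> e) w"
proof -
  let ?f = "t \<odot> e \<odot> sinv T t"
  have f: "?f \<in> idems T" using t e by simp
  have ew: "T.act e w = e" using e w by (intro T.act_idem)
  have fr: "?f \<odot> ran_idem T t = ?f" using t e by (simp add: ran_idem_def)
  \<comment> \<open>The range idempotent of \<open>t\<close> is split off from \<open>?f\<close>,
    because reading \<open>u\<close> from it gives exactly \<open>t\<close>.\<close>
  have fu: "T.act ?f u = t \<odot> e"
  proof -
    have "T.act ?f u = ?f \<odot> T.act (ran_idem T t) u"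
      using T.act_mult[of ?f "ran_idem T t" u] f t u fr by (simp del: T.assoc)
    also have "\<dots> = t \<odot> e" using T.act_ran_idem[OF u(2,1)] t e by (simp add: T.mult_idem_swap)
    finally show ?thesis .
  qed
  have tew: "T.act (t \<odot> e) w = t \<odot> e" using T.act_mult[of t e w] t e w ew by simp
  have fw: "T.act ?f (u @ w @ inv_word u) = ?f"
    using f u w t e by (intro T.act_idem T.below_conj) simp_all
  have "twist s ?f (reduce (u @ w @ inv_word u)) = twist s ?f (u @ w @ inv_word u)"
    using s f u w fw by (intro twist_reduce) simp_all
  also have "\<dots> = twist s ?f u \<star> (twist s (t \<odot> e) w \<star> twist s (t \<odot> e) (inv_word u))"
    using twist_append[of s ?f u "w @ inv_word u"] twist_append[of s "t \<odot> e" w "inv_word u"]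
      s t e f u w fu tew by (simp del: T.assoc)
  also have "\<dots> = (twist s ?f u \<star> twist s (T.act ?f u) (inv_word u)) \<star> twist s (t \<odot> e) w"
    unfolding fu using s t e f u w by (simp add: A.ac)
  also have "nat_le A \<dots> (twist s (t \<odot> e) w)"
    using s t e f u w by (intro A.nat_le_idem_mult twist_inv_word) simp_all
  finally have "nat_le A (twist s ?f (reduce (u @ w @ inv_word u))) (twist s (t \<odot> e) w)" .
  moreover have "ran_idem A (twist s ?f (reduce (u @ w @ inv_word u))) = \<rho> (s \<odot> ?f)"
    using s f u w T.act_idem[OF f T.below_reduce[OF T.below_conj[OF u(2) w(2) u(1) w(1)]]]
    by (simp add: ran_twist del: T.assoc)
  moreover have "\<rho> (s \<odot> ?f) = \<rho> (s \<odot> (t \<odot> e))"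
    using T.ran_idem_mult[of s ?f] T.ran_idem_mult[of s "t \<odot> e"] T.ran_idem_mult_idem[OF t e]
      T.ran_idem_of_idem[OF f] s t e f by (simp del: T.assoc)
  ultimately show ?thesis
    using s t e w tew by (elim A.nat_le_ran_eq) (simp add: ran_twist del: T.assoc)
qed

lemma letter_twist_cocycle:
  assumes s: "s \<in> carrier T" and t: "t \<in> carrier T" and x: "x \<in> carrier T"
    and l: "set_letter l \<subseteq> carrier T"
  shows "\<eta> s (letter_twist t x l) \<star> letter_twist s (t \<odot> x) l \<star> c [s, t, x]
    = letter_twist (s \<odot> t) x l \<star> c [s, t, x \<odot> letter_val T l]"
proof (cases l)
  case (Pos y)
  then show ?thesis using cocycle_identity[of s t x y] assms by simp
next
  case (Neg y)
  let ?z = "x \<odot> sinv T y"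
  have y: "y \<in> carrier T" "?z \<in> carrier T" using Neg x l by auto
  let ?a = "\<eta> s (c [t, ?z, y])" and ?d = "c [s, t \<odot> ?z, y]" and ?e = "c [s, t, ?z]"
    and ?b = "c [s \<odot> t, ?z, y]" and ?f = "c [s, t, ?z \<odot> y]" and ?g = "c [s, t, x]"
  have c: "?a \<in> carrier A" "?b \<in> carrier A" "?d \<in> carrier A" "?e \<in> carrier A"
    "?f \<in> carrier A" "?g \<in> carrier A"
    using s t x y by (simp_all del: T.assoc)
  define r where "r = \<rho> (s \<odot> (t \<odot> ?z))"
  have r': "\<rho> (s \<odot> (t \<odot> (?z \<odot> y))) = r"
    using s t x y by (simp add: r_def ran_idem_def)
  have r: "r \<in> idems A" using s t x y by (simp add: r_def)
  have ran: "ran_idem A ?a = r" "ran_idem A ?b = r" "ran_idem A ?d = r" "ran_idem A ?e = r"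
      "ran_idem A ?f = r"
    using s t x y r' by (simp_all add: cochain ran_idem_eta eta_rho r_def[symmetric] del: T.assoc)
      (simp_all add: r_def)
  have id: "?a \<star> ?d \<star> ?e = ?b \<star> ?f" using cocycle_identity[of s t ?z y] s t y by simp
  \<comment> \<open>The cocycle identity is used at \<open>?z = x y^-1\<close>, so its last term
    sits at \<open>x y^-1 y\<close> and not at \<open>x\<close>. Order preservation shows that this
    changes the term only by the idempotent \<open>r\<close>, which the other factors
    absorb.\<close>
  have fg: "?f = r \<star> ?g"
  proof -
    have "nat_le A ?f ?g" using s t x y
      by (intro cochain_mono) (simp_all add: T.nat_le_mult_idem)
    from A.nat_le_ran[OF this] show ?thesis using ran by simp
  qed
  have "sinv A ?a \<star> sinv A ?d \<star> ?g = (r \<star> sinv A ?a) \<star> sinv A ?d \<star> ?g"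
    using A.ran_idem_eq[of "sinv A ?a" r] ran c by simp
  also have "\<dots> = sinv A ?a \<star> sinv A ?d \<star> ?f"
    unfolding fg using c r by (simp add: A.ac)
  also have "\<dots> = sinv A ?a \<star> sinv A ?d \<star> (ran_idem A ?b \<star> ?f)"
    using A.ran_idem_eq[OF c(5) ran(5)] ran by simp
  also have "\<dots> = sinv A ?a \<star> sinv A ?d \<star> sinv A ?b \<star> (?b \<star> ?f)"
    using c by (simp add: ran_idem_def[of A] A.ac)
  also have "\<dots> = ran_idem A ?a \<star> (ran_idem A ?d \<star> (sinv A ?b \<star> ?e))"
    unfolding id[symmetric] using c by (simp add: ran_idem_def[of A] A.ac)
  also have "\<dots> = sinv A ?b \<star> ?e"
    using A.ran_idem_eq_left[of "sinv A ?b" ?e r] ran c by simp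
  finally have "sinv A ?a \<star> sinv A ?d \<star> ?g = sinv A ?b \<star> ?e" .
  then show ?thesis using Neg s t x y by (simp add: eta_sinv)
qed

text \<open>Each letter replaces the boundary term \<open>c [s, t, x]\<close> by the one at the
  value reached after that letter, so only the two ends of the word remain.\<close>

lemma twist_cocycle:
  "\<lbrakk>s \<in> carrier T; t \<in> carrier T; x \<in> carrier T; w \<in> words (carrier T)\<rbrakk>
    \<Longrightarrow> \<eta> s (twist t x w) \<star> twist s (t \<odot> x) w \<star> c [s, t, x]
      = twist (s \<odot> t) x w \<star> c [s, t, T.act x w]"
proof (induction w arbitrary: x)
  case Nil
  have "\<rho> (s \<odot> (t \<odot> x)) \<star> c [s, t, x] = c [s, t, x]"
    using Nil by (intro A.ran_idem_eq) (simp_all add: cochain)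
  then show ?case using Nil by (simp add: eta_rho)
next
  case (Cons l w)
  let ?y = "x \<odot> letter_val T l"
  have y: "?y \<in> carrier T" and l: "set_letter l \<subseteq> carrier T" "w \<in> words (carrier T)"
    using Cons.prems by auto
  note st = Cons.prems(1-3)
  have "\<eta> s (twist t x (l # w)) \<star> twist s (t \<odot> x) (l # w) \<star> c [s, t, x]
    = (\<eta> s (letter_twist t x l) \<star> letter_twist s (t \<odot> x) l \<star> c [s, t, x]) \<star>
      (\<eta> s (twist t ?y w) \<star> twist s (t \<odot> ?y) w)"
    using st y l by (simp add: A.ac eta_mult)
  also have "\<dots> = letter_twist (s \<odot> t) x l \<star> (\<eta> s (twist t ?y w) \<star> twist s (t \<odot> ?y) w \<star> c [s, t, ?y])"
    unfolding letter_twist_cocycle[OF st l(1)] using st y l by (simp add: A.ac)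
  also have "\<dots> = letter_twist (s \<odot> t) x l \<star> (twist (s \<odot> t) ?y w \<star> c [s, t, T.act ?y w])"
    using Cons.IH[of ?y] st y l by (simp del: T.assoc A.assoc)
  also have "\<dots> = twist (s \<odot> t) x (l # w) \<star> c [s, t, T.act x (l # w)]"
    using st y l by simp
  finally show ?case .
qed

text \<open>For \<open>x = e\<close> the word leads back to \<open>e\<close>, so both boundary terms
  are \<open>c [s, t, e]\<close>. Normalization makes this an idempotent that the twists on both
  sides absorb.\<close>

lemma twist_comp:
  assumes s: "s \<in> carrier T" and t: "t \<in> carrier T" and e: "e \<in> idems T"
    and w: "w \<in> words (carrier T)" "T.below e w"
  shows "\<eta> s (twist t e w) \<star> twist s (t \<odot> e) w = twist (s \<odot> t) e w"
proof -
  have ew: "T.act e w = e" using e w by (intro T.act_idem)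
  have c: "c [s, t, e] = \<rho> (s \<odot> (t \<odot> e))" using s t e by (simp add: cochain_idem_right)
  have "\<eta> s (twist t e w) \<star> twist s (t \<odot> e) w \<star> \<rho> (s \<odot> (t \<odot> e)) = twist (s \<odot> t) e w \<star> \<rho> (s \<odot> (t \<odot> e))"
    using twist_cocycle[of s t e w] s t e w ew c by simp
  then show ?thesis
    using twist_absorb[of s "t \<odot> e" w] twist_absorb[of "s \<odot> t" e w] s t e w
      A.comm[of "twist (s \<odot> t) e w" "\<rho> (s \<odot> (t \<odot> e))"] A.comm[of "twist s (t \<odot> e) w" "\<rho> (s \<odot> (t \<odot> e))"]
    by simp
qed

text \<open>Both words fix \<open>e e'\<close>, so each can be read separately from there. Passing
  from \<open>e e'\<close> to \<open>e\<close> and to \<open>e'\<close> enlarges the factors, but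
  the product keeps its range because conjugation by \<open>t\<close> is multiplicative on
  idempotents.\<close>

lemma twist_mult:
  assumes t: "t \<in> carrier T" and e: "e \<in> idems T" and e': "e' \<in> idems T"
    and w: "w \<in> words (carrier T)" "T.below e w" and w': "w' \<in> words (carrier T)" "T.below e' w'"
  shows "twist t (e \<odot> e') (reduce (w @ w')) = twist t e w \<star> twist t e' w'"
proof -
  have ee: "e \<odot> e' \<in> idems T" using e e' by simp
  have 1: "T.act (e \<odot> e') w = e \<odot> e'"
    using T.act_mult[of e' e w] T.act_idem[OF e w(2,1)] e e' w by (simp add: T.idem_commute)
  have 2: "T.act (e \<odot> e') w' = e \<odot> e'"
    using T.act_mult[of e e' w'] T.act_idem[OF e' w'(2,1)] e e' w' by simp
  have "twist t (e \<odot> e') (reduce (w @ w')) = twist t (e \<odot> e') (w @ w')"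
    using t ee w w' 1 2 by (intro twist_reduce) (simp_all add: T.act_append)
  also have "\<dots> = twist t (e \<odot> e') w \<star> twist t (e \<odot> e') w'"
    using t ee w w' 1 by (simp add: twist_append)
  also have "\<dots> = twist t e w \<star> twist t e' w'"
  proof (rule A.nat_le_ran_eq)
    show "nat_le A (twist t (e \<odot> e') w \<star> twist t (e \<odot> e') w') (twist t e w \<star> twist t e' w')"
      using t e e' w w' by (intro A.nat_le_mult twist_mono T.nat_le_mult_idem T.nat_le_idem_mult) simp_all
    have "ran_idem T (t \<odot> e) \<odot> ran_idem T (t \<odot> e') = ran_idem T (t \<odot> (e \<odot> e'))"
    proof -
      have "ran_idem T (t \<odot> e) \<odot> ran_idem T (t \<odot> e') = t \<odot> (e \<odot> (sinv T t \<odot> t)) \<odot> (e' \<odot> sinv T t)"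
        using t e e' by (simp add: ran_idem_def)
      also have "\<dots> = t \<odot> e \<odot> (e' \<odot> sinv T t)"
        using t e by (simp only: T.mult_idem_swap)
      also have "\<dots> = ran_idem T (t \<odot> (e \<odot> e'))"
        using t e e' ee T.ran_idem_mult_idem[OF t ee] by simp
      finally show ?thesis .
    qed
    then show "ran_idem A (twist t (e \<odot> e') w \<star> twist t (e \<odot> e') w') = ran_idem A (twist t e w \<star> twist t e' w')"
      using t e e' ee w w' 1 2 T.act_idem[OF e w(2,1)] T.act_idem[OF e' w'(2,1)]
      by (simp add: A.ran_idem_mult_comm ran_twist theta_mult)
  qed
  finally show ?thesis .
qed

lemma twist_idem:
  "\<lbrakk>e \<in> idems T; x \<in> carrier T; w \<in> words (carrier T)\<rbrakk> \<Longrightarrow> twist e x w \<in> idems A"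
proof (induction w arbitrary: x)
  case (Cons l w)
  have "letter_twist e x l \<in> idems A"
    using Cons.prems by (cases l) (auto simp: cochain_idem_left)
  with Cons show ?case by simp
qed simp

lemma twist_idem_eq:
  assumes "f \<in> idems T" "e \<in> idems T" "w \<in> words (carrier T)" "T.below e w"
  shows "twist f e w = \<theta> (f \<odot> e)"
  using ran_twist[of f e w] twist_idem[of f e w] T.act_idem[of e w] assms by simp

end

section \<open>The crossed module\<close>

lemma inv_word_conj_mult:
  "reduce (u @ reduce (w @ w') @ inv_word u)
    = reduce (reduce (u @ w @ inv_word u) @ reduce (u @ w' @ inv_word u))"
proof -
  have "reduce (reduce (u @ w @ inv_word u) @ reduce (u @ w' @ inv_word u))
      = reduce ((u @ w) @ (inv_word u @ u) @ (w' @ inv_word u))"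
    by (simp only: reduce_append_left reduce_append_right append_assoc)
  also have "\<dots> = reduce ((u @ w) @ reduce (inv_word u @ u) @ (w' @ inv_word u))"
    by (simp only: reduce_reduce_middle)
  also have "\<dots> = reduce (u @ (w @ w') @ inv_word u)" by simp
  also have "\<dots> = reduce (u @ reduce (w @ w') @ inv_word u)" by (simp only: reduce_reduce_middle)
  finally show ?thesis ..
qed

lemma inv_word_conj_comp:
  "reduce (u @ reduce (v @ w @ inv_word v) @ inv_word u)
    = reduce (reduce (u @ v) @ w @ inv_word (reduce (u @ v)))"
proof -
  have "reduce (reduce (u @ v) @ w @ inv_word (reduce (u @ v)))
      = reduce ((reduce (u @ v) @ w) @ inv_word (u @ v))"
    using reduce_inv_word_reduce[of "reduce (u @ v) @ w" "u @ v"] by simp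
  also have "\<dots> = reduce (u @ (v @ w @ inv_word v) @ inv_word u)"
    by (simp only: reduce_append_left append_assoc inv_word_simps)
  also have "\<dots> = reduce (u @ reduce (v @ w @ inv_word v) @ inv_word u)"
    by (simp only: reduce_reduce_middle)
  finally show ?thesis ..
qed

context ordered_cocycle
begin

section \<open>The semilattice of groups \<open>N\<close>\<close>

abbreviation S where "S \<equiv> ext_S T"
abbreviation N where "N \<equiv> ext_N T A \<theta>"

sublocale S: inverse_semigroup S
  by (rule T.inverse_semigroup_ext_S)

lemma carrier_N: "(a, e, w) \<in> carrier N \<longleftrightarrow>
    a \<in> carrier A \<and> ran_idem A a = \<theta> e \<and> e \<in> idems T \<and> w \<in> words (carrier T) \<and> reduced w
      \<and> T.below e w"
  by (auto simp: ext_N_def carrier_FG A.component_iff T.nat_le_nu_iff)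

lemma mult_N [simp]: "(a, e, w) \<cdot>\<^bsub>N\<^esub> (a', e', w') = (a \<star> a', e \<odot> e', reduce (w @ w'))"
  by (simp add: ext_N_def mult_FG)

lemma is_inverse_of_N:
  assumes "(a, e, w) \<in> carrier N"
  shows "is_inverse_of N (a, e, w) y \<longleftrightarrow> y = (sinv A a, e, reduce (inv_word w))"
proof
  have aew: "a \<in> carrier A" "ran_idem A a = \<theta> e" "e \<in> idems T" "w \<in> words (carrier T)"
      "reduced w" "T.below e w"
    using assms by (auto simp: carrier_N)
  have "T.below e (inv_word w)" using T.below_inv_word[OF aew(6,4)] aew by simp
  {
    assume "y = (sinv A a, e, reduce (inv_word w))"
    moreover have "reduce (reduce (w @ reduce (inv_word w)) @ w) = w"
      using aew by (simp add: reduce_append_right reduce_reduced)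
    moreover have "reduce (reduce (reduce (inv_word w) @ w) @ reduce (inv_word w)) = reduce (inv_word w)"
      by (simp add: reduce_append_left)
    ultimately show "is_inverse_of N (a, e, w) y"
      using aew \<open>T.below e (inv_word w)\<close> by (simp add: is_inverse_of_def carrier_N T.below_reduce)
  }
  {
    assume y: "is_inverse_of N (a, e, w) y"
    obtain b f v where bfv: "y = (b, f, v)" by (cases y)
    have "is_inverse_of A a b" "is_inverse_of T e f" "reduced v" "reduce (reduce (w @ v) @ w) = w"
      using y aew by (auto simp: is_inverse_of_def bfv carrier_N)
    then show "y = (sinv A a, e, reduce (inv_word w))"
      using bfv aew A.sinv_eqI[of a b] T.sinv_eqI[of e f] reduce_inverse_unique[of v w] by simp
  }
qed

lemma inverse_semigroup_N: "inverse_semigroup N"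
proof
  fix x y assume "x \<in> carrier N" "y \<in> carrier N"
  then show "x \<cdot>\<^bsub>N\<^esub> y \<in> carrier N"
    by (cases x; cases y)
      (auto simp: carrier_N A.ran_idem_mult_comm theta_mult intro: T.below_reduce T.below_append)
next
  fix x y z assume "x \<in> carrier N" "y \<in> carrier N" "z \<in> carrier N"
  then show "x \<cdot>\<^bsub>N\<^esub> y \<cdot>\<^bsub>N\<^esub> z = x \<cdot>\<^bsub>N\<^esub> (y \<cdot>\<^bsub>N\<^esub> z)"
    by (cases x; cases y; cases z) (auto simp: carrier_N reduce_append_left reduce_append_right)
next
  fix x assume "x \<in> carrier N"
  then show "\<exists>!y. is_inverse_of N x y"
    by (cases x) (auto simp: is_inverse_of_N)
qed

sublocale N: inverse_semigroup N
  by (rule inverse_semigroup_N)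

lemma sinv_N: "(a, e, w) \<in> carrier N \<Longrightarrow> sinv N (a, e, w) = (sinv A a, e, reduce (inv_word w))"
  by (simp add: sinv_def[of N] is_inverse_of_N)

lemma idem_in_N [simp]: "e \<in> idems T \<Longrightarrow> (\<theta> e, e, []) \<in> carrier N"
  by (simp add: carrier_N)

lemma idems_N: "idems N = (\<lambda>e. (\<theta> e, e, [])) ` idems T"
proof (intro equalityI subsetI)
  fix x assume "x \<in> idems N"
  then have "x \<in> carrier N" "x \<cdot>\<^bsub>N\<^esub> x = x" by (rule N.idems_carrier, rule N.idem_mult_self)
  then obtain a e w where *: "x = (a, e, w)" "(a, e, w) \<in> carrier N" "a \<star> a = a" "reduce (w @ w) = w"
    by (cases x) auto
  have "a \<in> idems A" using * by (intro A.idemsI) (simp_all add: carrier_N)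
  then show "x \<in> (\<lambda>e. (\<theta> e, e, [])) ` idems T"
    using * reduce_square_Nil[of w] by (auto simp: carrier_N)
next
  fix x :: "'a \<times> 't \<times> 't letter list" assume "x \<in> (\<lambda>e. (\<theta> e, e, [])) ` idems T"
  then obtain e where "e \<in> idems T" "x = (\<theta> e, e, [])" by blast
  then show "x \<in> idems N" by (intro N.idemsI) simp_all
qed

text \<open>The groups are the fibres of the idempotent coordinate. The fibre over \<open>e\<close>
  is the component of \<open>\<theta> e\<close> times the subgroup of words \<open>w\<close> with
  \<open>e \<le> \<nu>(w)\<close>.\<close>

lemma semilattice_of_groups_N: "semilattice_of_groups N"
  unfolding semilattice_of_groups_def
proof (intro conjI exI[of _ "(\<lambda>e. {n \<in> carrier N. fst (snd n) = e}) ` idems T"] ballI)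
  let ?H = "\<lambda>e. {n \<in> carrier N. fst (snd n) = e}"
  show "inverse_semigroup N" by (rule inverse_semigroup_N)
  show "partition_on (carrier N) (?H ` idems T)"
  proof (rule partition_onI)
    show "\<Union> (?H ` idems T) = carrier N" by (auto simp: carrier_N)
    show "{} \<notin> ?H ` idems T" using idem_in_N by fastforce
  qed (auto simp: disjnt_def)
  fix H assume "H \<in> ?H ` idems T"
  then obtain e where e: "e \<in> idems T" "H = ?H e" by blast
  show "\<exists>f. group \<lparr>carrier = H, monoid.mult = sgmult N, one = f\<rparr>"
  proof (rule exI[of _ "(\<theta> e, e, [])"], rule groupI)
    fix x assume "x \<in> carrier \<lparr>carrier = H, monoid.mult = sgmult N, one = (\<theta> e, e, [])\<rparr>"
    then obtain a w where x: "x = (a, e, w)" "(a, e, w) \<in> carrier N" using e by (cases x) auto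
    then have a: "a \<in> carrier A" "ran_idem A a = \<theta> e" "reduced w" by (auto simp: carrier_N)
    show "\<one>\<^bsub>\<lparr>carrier = H, monoid.mult = sgmult N, one = (\<theta> e, e, [])\<rparr>\<^esub>
        \<otimes>\<^bsub>\<lparr>carrier = H, monoid.mult = sgmult N, one = (\<theta> e, e, [])\<rparr>\<^esub> x = x"
      using x e a A.ran_idem_eq[OF a(1,2)] by (simp add: reduce_reduced)
    have "sinv N x \<in> carrier N" using x by simp
    then show "\<exists>y \<in> carrier \<lparr>carrier = H, monoid.mult = sgmult N, one = (\<theta> e, e, [])\<rparr>.
        y \<otimes>\<^bsub>\<lparr>carrier = H, monoid.mult = sgmult N, one = (\<theta> e, e, [])\<rparr>\<^esub> x
          = \<one>\<^bsub>\<lparr>carrier = H, monoid.mult = sgmult N, one = (\<theta> e, e, [])\<rparr>\<^esub>"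
      using x e a A.comm[of "sinv A a" a]
      by (intro bexI[of _ "sinv N x"]) (simp_all add: sinv_N ran_idem_def reduce_append_left)
  qed (use e in auto)
qed

lemma central_N: "\<lbrakk>n \<in> carrier N; e \<in> idems N\<rbrakk> \<Longrightarrow> n \<cdot>\<^bsub>N\<^esub> e = e \<cdot>\<^bsub>N\<^esub> n"
  using semilattice_of_groups_N by (rule semilattice_of_groups_idem_central)

section \<open>The closed form of \<open>\<lambda>\<close>\<close>

lemma xi_Pos: "xi T A \<theta> c t (Pos x # u) = twist t x u"
proof (induction u arbitrary: x)
  case (Cons l u)
  then show ?case by (cases l) auto
qed simp

text \<open>Starting from \<open>e\<close> instead of the first letter adds, for a positive letter
  \<open>x\<close>, the factor \<open>c [t, e, x]\<close>, idempotent by normalization. Otherwise it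
  only shrinks the values at which the remaining factors are taken.\<close>

lemma twist_le_zeta:
  assumes t: "t \<in> carrier T" and e: "e \<in> idems T" and w: "w \<in> words (carrier T)"
  shows "nat_le A (twist t e w) (zeta T A \<theta> c t w)"
proof (cases w)
  case Nil
  have "nat_le T (ran_idem T (t \<odot> e)) (ran_idem T t)"
    using t e by (intro T.nat_le_ran_idem T.nat_le_mult_idem)
  from T.nat_le_ran[OF this] have "ran_idem T (t \<odot> e) \<odot> ran_idem T t = ran_idem T (t \<odot> e)"
    using t e by simp
  then show ?thesis
    using t e Nil by (intro A.nat_leI[of "\<rho> (t \<odot> e)"]) (simp_all add: zeta_def theta_mult)
next
  case (Cons l u)
  then have l: "set_letter l \<subseteq> carrier T" and u: "u \<in> words (carrier T)" using w by auto
  show ?thesis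
  proof (cases l)
    case (Pos x)
    then have x: "x \<in> carrier T" using l by simp
    have "nat_le A (\<rho> (t \<odot> (e \<odot> x)) \<star> twist t (e \<odot> x) u) (twist t (e \<odot> x) u)"
      using t e x u by (intro A.nat_le_idem_mult) simp_all
    also have "nat_le A \<dots> (twist t x u)"
      using t e x u by (intro twist_mono T.nat_le_idem_mult)
    finally (A.nat_le_trans) show ?thesis
      using Cons Pos t e x by (simp add: zeta_def xi_Pos cochain_idem_middle)
  next
    case (Neg x)
    then have x: "x \<in> carrier T" using l by simp
    have "nat_le T (e \<odot> sinv T x) (sinv T x)" using e x by (intro T.nat_le_idem_mult) simp_all
    then have "nat_le A (sinv A (c [t, e \<odot> sinv T x, x]) \<star> twist t (e \<odot> sinv T x) u)
        (sinv A (c [t, sinv T x, x]) \<star> twist t (sinv T x) u)"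
      using t x u by (intro A.nat_le_mult A.nat_le_sinv cochain_mono twist_mono) simp_all
    then show ?thesis using Cons Neg by (simp add: zeta_def xi_Pos)
  qed
qed

text \<open>The closed form of \<open>\<lambda>\<^sub>(\<^sub>t\<^sub>,\<^sub>u\<^sub>)\<close>: the \<open>A\<close>-component does not depend on \<open>u\<close>.\<close>

definition lam :: "'t \<Rightarrow> 't letter list \<Rightarrow> 'a \<times> 't \<times> 't letter list \<Rightarrow> 'a \<times> 't \<times> 't letter list" where
  "lam t u = (\<lambda>(a, e, w). (twist t e w \<star> \<eta> t a, t \<odot> (e \<odot> sinv T t), reduce (u @ w @ inv_word u)))"

lemma lam_simp [simp]: "lam t u (a, e, w) =
    (twist t e w \<star> \<eta> t a, t \<odot> (e \<odot> sinv T t), reduce (u @ w @ inv_word u))"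
  by (simp add: lam_def)

lemma rho_mult_idem: "\<lbrakk>t \<in> carrier T; e \<in> idems T\<rbrakk> \<Longrightarrow> \<rho> (t \<odot> e) = \<theta> (t \<odot> (e \<odot> sinv T t))"
  by (simp add: T.ran_idem_mult_idem)

lemma ran_eta:
  "\<lbrakk>t \<in> carrier T; a \<in> carrier A; e \<in> idems T; ran_idem A a = \<theta> e\<rbrakk>
    \<Longrightarrow> ran_idem A (\<eta> t a) = \<theta> (t \<odot> (e \<odot> sinv T t))"
  by (simp add: ran_idem_eta eta_theta)

lemma lam_closed:
  assumes "(t, u) \<in> carrier S" "n \<in> carrier N" shows "lam t u n \<in> carrier N"
proof -
  obtain a e w where n: "n = (a, e, w)" by (cases n)
  have h: "t \<in> carrier T" "u \<in> words (carrier T)" "T.below t u" "a \<in> carrier A"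
      "ran_idem A a = \<theta> e" "e \<in> idems T" "w \<in> words (carrier T)" "T.below e w"
    using assms n by (auto simp: T.carrier_ext_S carrier_N)
  have "T.below (t \<odot> (e \<odot> sinv T t)) (u @ w @ inv_word u)"
    using T.below_conj[OF h(3,8,2,7)] h by simp
  then show ?thesis
    using h n T.act_idem[OF h(6,8,7)]
    by (simp add: carrier_N T.below_reduce A.ran_idem_mult_comm ran_twist ran_eta rho_mult_idem)
qed

lemma lam_mult:
  assumes "(t, u) \<in> carrier S" "n \<in> carrier N" "m \<in> carrier N"
  shows "lam t u (n \<cdot>\<^bsub>N\<^esub> m) = lam t u n \<cdot>\<^bsub>N\<^esub> lam t u m"
proof -
  obtain a e w a' e' w' where nm: "n = (a, e, w)" "m = (a', e', w')" by (cases n; cases m)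
  have h: "t \<in> carrier T" "a \<in> carrier A" "e \<in> idems T" "w \<in> words (carrier T)" "T.below e w"
      "a' \<in> carrier A" "e' \<in> idems T" "w' \<in> words (carrier T)" "T.below e' w'"
    using assms nm by (auto simp: T.carrier_ext_S carrier_N)
  have "t \<odot> (e \<odot> e' \<odot> sinv T t) = (t \<odot> (e \<odot> (sinv T t \<odot> t))) \<odot> (e' \<odot> sinv T t)"
    unfolding T.mult_idem_swap[OF h(1,3)] using h by simp
  also have "\<dots> = (t \<odot> (e \<odot> sinv T t)) \<odot> (t \<odot> (e' \<odot> sinv T t))" using h by simp
  finally have "t \<odot> (e \<odot> e' \<odot> sinv T t) = (t \<odot> (e \<odot> sinv T t)) \<odot> (t \<odot> (e' \<odot> sinv T t))" .
  moreover have "twist t (e \<odot> e') (reduce (w @ w')) \<star> \<eta> t (a \<star> a')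
      = (twist t e w \<star> \<eta> t a) \<star> (twist t e' w' \<star> \<eta> t a')"
    using h by (simp add: twist_mult eta_mult A.left_comm)
  ultimately show ?thesis
    unfolding nm mult_N lam_simp inv_word_conj_mult by simp
qed

text \<open>The outer twist runs along a conjugated word; \<open>twist_conj\<close> turns it into a
  twist along \<open>w\<close> from \<open>t e\<close>, which is what \<open>twist_comp\<close>
  merges with the inner one.\<close>

lemma lam_comp:
  assumes "(s, u) \<in> carrier S" "(t, v) \<in> carrier S" "n \<in> carrier N"
  shows "lam s u (lam t v n) = lam (s \<odot> t) (reduce (u @ v)) n"
proof -
  obtain a e w where n: "n = (a, e, w)" by (cases n)
  have h: "s \<in> carrier T" "t \<in> carrier T" "v \<in> words (carrier T)" "T.below t v" "a \<in> carrier A"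
      "e \<in> idems T" "w \<in> words (carrier T)" "T.below e w"
    using assms n by (auto simp: T.carrier_ext_S carrier_N)
  have "twist s (t \<odot> (e \<odot> sinv T t)) (reduce (v @ w @ inv_word v)) = twist s (t \<odot> e) w"
    using twist_conj[OF h(1,2,6,3,4,7,8)] h by simp
  then have "twist s (t \<odot> (e \<odot> sinv T t)) (reduce (v @ w @ inv_word v)) \<star> \<eta> s (twist t e w \<star> \<eta> t a)
      = (\<eta> s (twist t e w) \<star> twist s (t \<odot> e) w) \<star> \<eta> (s \<odot> t) a"
    using h by (simp add: eta_mult eta_comp A.left_comm)
  also have "\<dots> = twist (s \<odot> t) e w \<star> \<eta> (s \<odot> t) a"
    using twist_comp[OF h(1,2,6,7,8)] by simp
  finally show ?thesis
    unfolding n lam_simp inv_word_conj_comp using h by simp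
qed

lemma lam_idem:
  assumes f: "f \<in> idems T" and n: "n \<in> carrier N"
  shows "lam f [] n = (\<theta> f, f, []) \<cdot>\<^bsub>N\<^esub> n"
proof -
  obtain a e w where aew: "n = (a, e, w)" by (cases n)
  have h: "a \<in> carrier A" "ran_idem A a = \<theta> e" "e \<in> idems T" "w \<in> words (carrier T)" "reduced w"
      "T.below e w"
    using n aew by (auto simp: carrier_N)
  have "\<theta> (f \<odot> e) \<star> (\<theta> f \<star> a) = \<theta> f \<star> (\<theta> e \<star> a)"
    using f h by (simp add: A.left_comm flip: theta_mult)
  also have "\<dots> = \<theta> f \<star> a" using A.ran_idem_eq[OF h(1,2)] by simp
  finally have "twist f e w \<star> \<eta> f a = \<theta> f \<star> a"
    using twist_idem_eq[OF f h(3,4,6)] f h by (simp add: eta_idem)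
  moreover have "f \<odot> (e \<odot> f) = f \<odot> e" using f h T.idem_commute[of e f] by simp
  ultimately show ?thesis using aew f h by (simp add: reduce_reduced)
qed

lemma lam_alpha:
  assumes "(t, u) \<in> carrier S" "e \<in> idems T"
  shows "lam t u (\<theta> e, e, []) = (\<theta> (t \<odot> (e \<odot> sinv T t)), t \<odot> (e \<odot> sinv T t), [])"
proof -
  have "t \<in> carrier T" using assms by (simp add: T.carrier_ext_S)
  then show ?thesis using assms by (simp add: eta_theta rho_mult_idem)
qed

text \<open>\<open>twist t e w\<close> is \<open>zeta\<close> times the idempotent
  \<open>\<theta>(t e t^-1)\<close>. This is the range idempotent of \<open>\<eta> t a\<close>, so
  the two products with \<open>\<eta> t a\<close> agree.\<close>

lemma gam_eq_lam:
  assumes l: "set_letter l \<subseteq> carrier T" and n: "n \<in> carrier N"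
  shows "gam T A \<theta> \<eta> c l n = lam (letter_val T l) [l] n"
proof -
  obtain a e w where aew: "n = (a, e, w)" by (cases n)
  have h: "a \<in> carrier A" "ran_idem A a = \<theta> e" "e \<in> idems T" "w \<in> words (carrier T)" "T.below e w"
    using n aew by (auto simp: carrier_N)
  have z: "zeta T A \<theta> c t w \<star> \<eta> t a = twist t e w \<star> \<eta> t a" if t: "t \<in> carrier T" for t
  proof -
    have le: "nat_le A (twist t e w) (zeta T A \<theta> c t w)" using t h by (intro twist_le_zeta)
    have zc: "zeta T A \<theta> c t w \<in> carrier A" using A.nat_le_carrier[OF le] by simp
    have "twist t e w = \<theta> (t \<odot> (e \<odot> sinv T t)) \<star> zeta T A \<theta> c t w"
      using A.nat_le_ran[OF le] t h T.act_idem[OF h(3,5,4)] by (simp add: ran_twist rho_mult_idem)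
    then have "twist t e w \<star> \<eta> t a = zeta T A \<theta> c t w \<star> (\<theta> (t \<odot> (e \<odot> sinv T t)) \<star> \<eta> t a)"
      using t h zc by (simp add: A.left_comm)
    also have "\<dots> = zeta T A \<theta> c t w \<star> \<eta> t a"
      using A.ran_idem_eq[OF _ ran_eta[OF t h(1,3,2)]] t h by simp
    finally show ?thesis ..
  qed
  show ?thesis
  proof (cases l)
    case (Pos t)
    then show ?thesis using aew l h by (simp add: z mult_FG reduce_append_left)
  next
    case (Neg t)
    then show ?thesis using aew l h by (simp add: z mult_FG reduce_append_left)
  qed
qed

lemma word_val_in_S:
  assumes "reduced u" "u \<in> words (carrier T)" "u \<noteq> []"
  shows "(word_val T u, u) \<in> carrier S"
proof -
  obtain l v where u: "u = l # v" using assms by (cases u) auto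
  have l: "letter_val T l \<in> carrier T" "v \<in> words (carrier T)" using assms u by auto
  then have "word_val T u = T.act (ran_idem T (letter_val T l)) u"
    using u by (simp add: T.word_val_Cons)
  then have "T.below (word_val T u) u" using l by (auto simp: T.below_def)
  then show ?thesis using assms u l by (simp add: T.carrier_ext_S T.word_val_Cons)
qed

lemma foldr_gam:
  "\<lbrakk>reduced u; u \<in> words (carrier T); u \<noteq> []; n \<in> carrier N\<rbrakk>
    \<Longrightarrow> foldr (gam T A \<theta> \<eta> c) u n = lam (word_val T u) u n"
proof (induction u)
  case (Cons l v)
  have l: "set_letter l \<subseteq> carrier T" and v: "v \<in> words (carrier T)" "reduced v"
    using Cons.prems by (auto simp: reduced_Cons)
  show ?case
  \<comment> \<open>\<open>word_val\<close> has no meaningful value at the empty word, so one-letter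
    words form the actual base case.\<close>
  proof (cases "v = []")
    case True
    then show ?thesis using gam_eq_lam[OF l Cons.prems(4)] by (simp add: T.word_val_Cons)
  next
    case False
    then have vS: "(word_val T v, v) \<in> carrier S" using v word_val_in_S by blast
    have lS: "(letter_val T l, [l]) \<in> carrier S"
      using word_val_in_S[of "[l]"] l by (simp add: T.word_val_Cons reduced_Cons)
    obtain k v' where k: "v = k # v'" using False by (cases v) auto
    have wv: "word_val T (l # v) = letter_val T l \<odot> word_val T v"
      using k l v by (simp add: T.word_val_Cons T.act_mult)
    have "foldr (gam T A \<theta> \<eta> c) (l # v) n = gam T A \<theta> \<eta> c l (lam (word_val T v) v n)"
      using Cons.IH Cons.prems v False by simp
    also have "\<dots> = lam (letter_val T l) [l] (lam (word_val T v) v n)"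
      using l Cons.prems(4) vS by (intro gam_eq_lam lam_closed)
    also have "\<dots> = lam (word_val T (l # v)) (l # v) n"
      using lam_comp[OF lS vS Cons.prems(4)] Cons.prems(1) wv by (simp add: reduce_reduced)
    finally show ?thesis .
  qed
qed simp

text \<open>For nonempty \<open>u\<close>, the pair \<open>(t, u)\<close> is the range idempotent of
  \<open>t\<close> paired with the empty word, times \<open>(word_val T u, u)\<close>. These factors
  match the two in the definition of \<open>ext_lambda\<close>, and \<open>lam_comp\<close>
  multiplies them.\<close>

lemma ext_lambda_eq:
  assumes tu: "(t, u) \<in> carrier S" and n: "n \<in> carrier N"
  shows "ext_lambda T A \<theta> \<eta> c (t, u) n = lam t u n"
proof (cases u)
  case Nil
  then have "t \<in> idems T" using tu by (simp add: T.carrier_ext_S)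
  then show ?thesis
    using Nil n lam_idem[of t n] by (simp add: ext_lambda_def ext_alpha_def)
next
  case (Cons l v)
  have h: "t \<in> carrier T" "u \<in> words (carrier T)" "reduced u" "T.below t u"
    using tu by (auto simp: T.carrier_ext_S)
  have p: "(word_val T u, u) \<in> carrier S" using word_val_in_S h Cons by blast
  have r: "(ran_idem T t, []) \<in> carrier S" using h by (simp add: T.carrier_ext_S)
  have "ran_idem T t \<odot> word_val T u = t"
    using T.act_ran_idem[OF h(4,2)] h Cons by (simp add: T.word_val_Cons T.act_mult)
  then have "lam t u n = lam (ran_idem T t) [] (lam (word_val T u) u n)"
    using lam_comp[OF r p n] h by (simp add: reduce_reduced)
  also have "\<dots> = (\<theta> (ran_idem T t), ran_idem T t, []) \<cdot>\<^bsub>N\<^esub> foldr (gam T A \<theta> \<eta> c) u n"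
    using lam_idem[OF _ lam_closed[OF p n]] foldr_gam[of u n] h n Cons by simp
  finally show ?thesis
    using n Cons T.ran_idem_ext_S[OF tu] by (simp add: ext_lambda_def ext_alpha_def)
qed

section \<open>The crossed module axioms\<close>

lemma ext_lambda_hom: "s \<in> carrier S \<Longrightarrow> ext_lambda T A \<theta> \<eta> c s \<in> sg_hom N N"
  by (cases s) (simp add: sg_hom_def ext_lambda_eq lam_closed lam_mult)

lemma ext_lambda_extensional: "ext_lambda T A \<theta> \<eta> c s \<in> extensional (carrier N)"
  by (cases s) (simp add: ext_lambda_def)

lemma ext_lambda_comp:
  assumes "s \<in> carrier S" "s' \<in> carrier S" "n \<in> carrier N"
  shows "ext_lambda T A \<theta> \<eta> c s (ext_lambda T A \<theta> \<eta> c s' n)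
    = ext_lambda T A \<theta> \<eta> c (s \<cdot>\<^bsub>S\<^esub> s') n"
proof -
  obtain t u t' u' where s: "s = (t, u)" "s' = (t', u')" by (cases s; cases s')
  have "(t, u) \<cdot>\<^bsub>S\<^esub> (t', u') \<in> carrier S" using assms s S.closed by blast
  then show ?thesis using assms s by (simp add: ext_lambda_eq lam_closed lam_comp)
qed

lemma ext_lambda_idem:
  "\<lbrakk>e \<in> idems S; n \<in> carrier N\<rbrakk> \<Longrightarrow> ext_lambda T A \<theta> \<eta> c e n = ext_alpha \<theta> e \<cdot>\<^bsub>N\<^esub> n"
  by (cases e) (simp add: T.idems_ext_S ext_lambda_def)

lemma ext_lambda_alpha:
  assumes "s \<in> carrier S" "e \<in> idems S"
  shows "ext_lambda T A \<theta> \<eta> c s (ext_alpha \<theta> e) = ext_alpha \<theta> (s \<cdot>\<^bsub>S\<^esub> e \<cdot>\<^bsub>S\<^esub> sinv S s)"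
proof -
  obtain t u f where s: "s = (t, u)" "e = (f, [])" "f \<in> idems T"
    using assms by (cases s) (auto simp: T.idems_ext_S)
  have "t \<in> carrier T" using assms s by (simp add: T.carrier_ext_S)
  then show ?thesis
    using assms s lam_alpha[of t u f]
    by (simp add: ext_alpha_def ext_lambda_eq T.sinv_ext_S del: lam_simp)
qed

lemma ext_alpha_idem: "e \<in> idems S \<Longrightarrow> ext_alpha \<theta> e \<in> idems N"
  by (auto simp: T.idems_ext_S idems_N ext_alpha_def)

text \<open>The partner of \<open>\<lambda>_s\<close> is the map of \<open>s^-1\<close>, with
  idempotent \<open>\<alpha>(s^-1 s)\<close>, which \<open>\<lambda>_s\<close> sends to
  \<open>\<alpha>(s s^-1)\<close>. The equations \<open>s s^-1 s = s\<close> and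
  \<open>s^-1 s s^-1 = s^-1\<close> make these left identities of the images; centrality of
  idempotents makes them two-sided.\<close>

lemma relatively_invertible_ext_lambda:
  assumes s: "s \<in> carrier S"
  shows "relatively_invertible N (ext_lambda T A \<theta> \<eta> c s)"
proof -
  let ?L = "ext_lambda T A \<theta> \<eta> c"
  define s' where "s' = sinv S s"
  have s': "s' \<in> carrier S" "s \<cdot>\<^bsub>S\<^esub> (s' \<cdot>\<^bsub>S\<^esub> s) = s" "s' \<cdot>\<^bsub>S\<^esub> (s \<cdot>\<^bsub>S\<^esub> s') = s'"
      "s' \<cdot>\<^bsub>S\<^esub> s \<in> idems S" "s \<cdot>\<^bsub>S\<^esub> s' \<in> idems S"
    using s by (simp_all add: s'_def)
  define e where "e = ext_alpha \<theta> (s' \<cdot>\<^bsub>S\<^esub> s)"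
  have e: "e \<in> idems N" unfolding e_def using s' by (intro ext_alpha_idem)
  have Le: "?L s e = ext_alpha \<theta> (s \<cdot>\<^bsub>S\<^esub> s')"
    using ext_lambda_alpha[OF s s'(4)] s s' unfolding e_def s'_def[symmetric] by simp
  have Lei: "?L s e \<in> idems N" unfolding Le using s' by (intro ext_alpha_idem)
  have 1: "?L s' (?L s n) = e \<cdot>\<^bsub>N\<^esub> n" if "n \<in> carrier N" for n
    using ext_lambda_comp[OF s'(1) s that] ext_lambda_idem[OF s'(4) that] by (simp add: e_def)
  have 2: "?L s (?L s' n) = ?L s e \<cdot>\<^bsub>N\<^esub> n" if "n \<in> carrier N" for n
    using ext_lambda_comp[OF s s'(1) that] ext_lambda_idem[OF s'(5) that] by (simp add: Le)
  have cl: "?L s n \<in> carrier N" "?L s' n \<in> carrier N" if "n \<in> carrier N" for n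
    by (rule sg_hom_closed[OF ext_lambda_hom[OF s] that], rule sg_hom_closed[OF ext_lambda_hom[OF s'(1)] that])
  have 3: "e \<cdot>\<^bsub>N\<^esub> ?L s' n = ?L s' n" if n: "n \<in> carrier N" for n
  proof -
    have "e \<cdot>\<^bsub>N\<^esub> ?L s' n = ?L s' (?L s (?L s' n))" using 1 cl n by simp
    also have "\<dots> = ?L (s' \<cdot>\<^bsub>S\<^esub> (s \<cdot>\<^bsub>S\<^esub> s')) n"
      using n s s'(1) cl by (simp add: ext_lambda_comp del: S.assoc)
    also have "\<dots> = ?L s' n" using s' by simp
    finally show ?thesis .
  qed
  have 4: "?L s e \<cdot>\<^bsub>N\<^esub> ?L s n = ?L s n" if n: "n \<in> carrier N" for n
  proof -
    have "?L s e \<cdot>\<^bsub>N\<^esub> ?L s n = ?L s (?L s' (?L s n))" using 2 cl n by simp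
    also have "\<dots> = ?L (s \<cdot>\<^bsub>S\<^esub> (s' \<cdot>\<^bsub>S\<^esub> s)) n"
      using n s s'(1) cl by (simp add: ext_lambda_comp del: S.assoc)
    also have "\<dots> = ?L s n" using s' by simp
    finally show ?thesis .
  qed
  have eN: "e \<in> carrier N" using e by simp
  have "e = ?L s' (?L s e)" using 1[OF eN] e by simp
  then have "e \<in> ?L s' ` carrier N" using cl eN by blast
  then have "is_identity_of N (?L s' ` carrier N) e"
    unfolding is_identity_of_def ball_simps using 3 central_N[OF cl(2) e] by simp
  moreover have "is_identity_of N (?L s ` carrier N) (?L s e)"
    unfolding is_identity_of_def ball_simps using 4 central_N[OF cl(1) Lei] imageI[OF eN] by simp
  ultimately show ?thesis
    unfolding relatively_invertible_def using 1 2 e ext_lambda_hom[OF s'(1)] by blast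
qed

lemma ext_lambda_in_hom: "ext_lambda T A \<theta> \<eta> c \<in> sg_hom S (rel_End N)"
proof -
  have "ext_lambda T A \<theta> \<eta> c (x \<cdot>\<^bsub>S\<^esub> y)
      = compose (carrier N) (ext_lambda T A \<theta> \<eta> c x) (ext_lambda T A \<theta> \<eta> c y)"
    if "x \<in> carrier S" "y \<in> carrier S" for x y
    using that by (intro extensionalityI[OF ext_lambda_extensional compose_extensional])
      (simp add: compose_def ext_lambda_comp)
  then show ?thesis
    by (simp add: sg_hom_def[of S] rel_End_def ext_lambda_hom ext_lambda_extensional
        relatively_invertible_ext_lambda)
qed

lemma ext_alpha_iso: "ext_alpha \<theta> \<in> sg_iso (idem_sgrp S) (idem_sgrp N)"
proof -
  have "bij_betw (ext_alpha \<theta>) (idems S) (idems N)"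
    by (auto simp: bij_betw_def inj_on_def T.idems_ext_S idems_N ext_alpha_def image_def)
  then show ?thesis
    by (auto simp: sg_iso_def sg_hom_def idem_sgrp_def bij_betw_def T.idems_ext_S
        ext_alpha_def theta_mult)
qed

lemma ext_beta_hom: "ext_beta \<in> sg_hom N S"
  by (auto simp: sg_hom_def ext_beta_def carrier_N T.carrier_ext_S)

text \<open>For an idempotent \<open>e\<close> the twist is idempotent by normalization, so the left
  side has \<open>A\<close>-component \<open>\<theta> e \<star> a'\<close>. On the right,
  commutativity of \<open>A\<close> collapses conjugation by \<open>a\<close> to the same
  element.\<close>

lemma ext_lambda_beta:
  assumes "n \<in> carrier N" "n' \<in> carrier N"
  shows "ext_lambda T A \<theta> \<eta> c (ext_beta n) n' = n \<cdot>\<^bsub>N\<^esub> n' \<cdot>\<^bsub>N\<^esub> sinv N n"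
proof -
  obtain a e w a' e' w' where n: "n = (a, e, w)" "n' = (a', e', w')" by (cases n; cases n')
  have h: "a \<in> carrier A" "ran_idem A a = \<theta> e" "e \<in> idems T" "w \<in> words (carrier T)"
      "a' \<in> carrier A" "ran_idem A a' = \<theta> e'" "e' \<in> idems T" "w' \<in> words (carrier T)" "T.below e' w'"
    using assms n by (auto simp: carrier_N)
  have eS: "(e, w) \<in> carrier S" using assms n by (auto simp: carrier_N T.carrier_ext_S)
  have "twist e e' w' \<star> \<eta> e a' = \<theta> e \<star> (\<theta> e' \<star> a')"
    using twist_idem_eq[OF h(3,7,8,9)] h by (simp add: eta_idem A.left_comm flip: theta_mult)
  also have "\<dots> = \<theta> e \<star> a'" using A.ran_idem_eq[OF h(5,6)] by simp
  also have "\<dots> = a \<star> (a' \<star> sinv A a)"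
    using h by (simp add: ran_idem_def A.ac flip: h(2))
  finally show ?thesis
    using assms n h eS by (simp add: ext_beta_def ext_lambda_eq sinv_N reduce_append_left reduce_append_right)
qed

lemma ext_beta_lambda:
  assumes "s \<in> carrier S" "n \<in> carrier N"
  shows "ext_beta (ext_lambda T A \<theta> \<eta> c s n) = s \<cdot>\<^bsub>S\<^esub> ext_beta n \<cdot>\<^bsub>S\<^esub> sinv S s"
proof -
  obtain t u a e w where sn: "s = (t, u)" "n = (a, e, w)" by (cases s; cases n)
  have "t \<in> carrier T" "e \<in> idems T" using assms sn by (auto simp: carrier_N T.carrier_ext_S)
  then show ?thesis
    using assms sn
    by (simp add: ext_lambda_eq ext_beta_def T.sinv_ext_S reduce_append_left reduce_append_right)
qed

lemma crossed_module_ext: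
  "crossed_module S N (ext_alpha \<theta>) (ext_lambda T A \<theta> \<eta> c) ext_beta"
proof -
  have "inj_on ext_beta (idems N)" by (auto simp: inj_on_def idems_N ext_beta_def)
  moreover have "ext_beta f = inv_into (idems S) (ext_alpha \<theta>) f" if f: "f \<in> idems N" for f
  proof -
    have inj: "inj_on (ext_alpha \<theta>) (idems S)"
      using ext_alpha_iso by (auto simp: sg_iso_def idem_sgrp_def bij_betw_def)
    obtain e where e: "e \<in> idems T" "f = (\<theta> e, e, [])" using f unfolding idems_N by blast
    then have "ext_alpha \<theta> (e, []) = f" "(e, []) \<in> idems S"
      by (auto simp: ext_alpha_def T.idems_ext_S)
    then have "inv_into (idems S) (ext_alpha \<theta>) f = (e, [])" using inv_into_f_f[OF inj] by blast
    moreover have "ext_beta f = (e, [])" using e by (simp add: ext_beta_def)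
    ultimately show ?thesis by simp
  qed
  ultimately show ?thesis
    unfolding crossed_module_def
    using S.inverse_semigroup_axioms semilattice_of_groups_N ext_alpha_iso ext_lambda_in_hom
      ext_beta_hom ext_lambda_idem ext_lambda_alpha ext_lambda_beta ext_beta_lambda
    by simp
qed

section \<open>Exactness of the sequence and the induced module\<close>

lemma ext_i_eq: "\<lbrakk>e \<in> idems T; ran_idem A a = \<theta> e\<rbrakk> \<Longrightarrow> ext_i T A \<theta> a = (a, e, [])"
  using inv_into_f_f[of \<theta> "idems T" e] bij_theta
  by (simp add: ext_i_def bij_betw_def flip: ran_idem_def)

lemma ext_iE:
  assumes "a \<in> carrier A"
  obtains e where "e \<in> idems T" "ran_idem A a = \<theta> e" "ext_i T A \<theta> a = (a, e, [])"
proof -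
  have "ran_idem A a \<in> \<theta> ` idems T" using assms bij_theta by (simp add: bij_betw_def)
  then show ?thesis using ext_i_eq that by auto
qed

lemma inj_ext_i: "inj_on (ext_i T A \<theta>) (carrier A)"
  by (auto simp: inj_on_def ext_i_def)

lemma ext_i_hom: "ext_i T A \<theta> \<in> sg_hom A N"
proof -
  have "ext_i T A \<theta> a \<in> carrier N" if "a \<in> carrier A" for a
    using ext_iE[OF that] that by (metis T.below_Nil carrier_N reduced_Nil words_Nil)
  moreover have "ext_i T A \<theta> (a \<star> b) = ext_i T A \<theta> a \<cdot>\<^bsub>N\<^esub> ext_i T A \<theta> b"
    if ab: "a \<in> carrier A" "b \<in> carrier A" for a b
  proof -
    obtain e where e: "e \<in> idems T" "ran_idem A a = \<theta> e" "ext_i T A \<theta> a = (a, e, [])"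
      using ext_iE[OF ab(1)] .
    obtain f where f: "f \<in> idems T" "ran_idem A b = \<theta> f" "ext_i T A \<theta> b = (b, f, [])"
      using ext_iE[OF ab(2)] .
    have "ext_i T A \<theta> (a \<star> b) = (a \<star> b, e \<odot> f, [])"
      using e f ab by (intro ext_i_eq) (simp_all add: A.ran_idem_mult_comm theta_mult)
    then show ?thesis using e f by simp
  qed
  ultimately show ?thesis by (auto simp: sg_hom_def)
qed

lemma ext_i_image: "ext_i T A \<theta> ` carrier A = {n \<in> carrier N. ext_beta n \<in> idems S}"
proof (intro equalityI subsetI)
  fix n assume "n \<in> ext_i T A \<theta> ` carrier A"
  then obtain a where a: "a \<in> carrier A" "n = ext_i T A \<theta> a" by blast
  obtain e where "e \<in> idems T" "ext_i T A \<theta> a = (a, e, [])" using ext_iE[OF a(1)] .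
  then show "n \<in> {n \<in> carrier N. ext_beta n \<in> idems S}"
    using a sg_hom_closed[OF ext_i_hom a(1)] by (simp add: ext_beta_def T.idems_ext_S)
next
  fix n assume "n \<in> {n \<in> carrier N. ext_beta n \<in> idems S}"
  then obtain a e where "n = (a, e, [])" "(a, e, []) \<in> carrier N"
    by (cases n) (auto simp: ext_beta_def T.idems_ext_S)
  then show "n \<in> ext_i T A \<theta> ` carrier A"
    using ext_i_eq[of e a] by (auto simp: carrier_N intro!: image_eqI[of _ _ a])
qed

lemma ext_beta_image: "ext_beta ` carrier N = {s \<in> carrier S. ext_pi s \<in> idems T}"
proof (intro equalityI subsetI)
  fix s assume "s \<in> {s \<in> carrier S. ext_pi s \<in> idems T}"
  then obtain e w where "s = (e, w)" "(e, w) \<in> carrier S" "e \<in> idems T"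
    by (cases s) (auto simp: ext_pi_def)
  then show "s \<in> ext_beta ` carrier N"
    \<comment> \<open>Any element of the component of \<open>\<theta> e\<close> would do as first
      coordinate; its identity is always available.\<close>
    by (intro image_eqI[of _ _ "(\<theta> e, e, w)"]) (simp_all add: carrier_N T.carrier_ext_S ext_beta_def)
qed (auto simp: carrier_N T.carrier_ext_S ext_beta_def ext_pi_def)

lemma ext_pi_image: "ext_pi ` carrier S = carrier T"
proof (intro equalityI subsetI)
  fix t assume "t \<in> carrier T"
  then have "(t, [Pos t]) \<in> carrier S"
    using T.below_letter[of "Pos t"] by (simp add: T.carrier_ext_S reduced_Cons)
  then show "t \<in> ext_pi ` carrier S" by (force simp: ext_pi_def)
qed (auto simp: T.carrier_ext_S ext_pi_def)

lemma inj_ext_pi: "inj_on ext_pi (idems S)"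
  by (auto simp: inj_on_def T.idems_ext_S ext_pi_def)

lemma crossed_module_extension_ext:
  "crossed_module_extension A (ext_i T A \<theta>) N ext_beta S ext_pi T
    (ext_alpha \<theta>) (ext_lambda T A \<theta> \<eta> c)"
proof -
  have "semilattice_of_abelian_groups A" using module by (simp add: T_module_def)
  moreover have "ext_pi \<in> sg_hom S T" by (auto simp: sg_hom_def ext_pi_def T.carrier_ext_S)
  ultimately show ?thesis
    unfolding crossed_module_extension_def
    using T.inverse_semigroup_axioms crossed_module_ext ext_i_hom inj_ext_i ext_pi_image
      inj_ext_pi ext_i_image ext_beta_image
    by simp
qed

text \<open>Elements of \<open>i(A)\<close> carry the empty word, so \<open>twist\<close> reduces to
  an idempotent absorbed by \<open>\<eta> t a\<close>, and conjugation by \<open>u\<close> leaves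
  the word empty. Hence only the first coordinate of \<open>s\<close> matters.\<close>

lemma induces_module_ext:
  "induces_module A (ext_i T A \<theta>) S ext_pi T (ext_alpha \<theta>) (ext_lambda T A \<theta> \<eta> c) \<theta> \<eta>"
  unfolding induces_module_def
proof (intro conjI ballI impI)
  fix e assume e: "e \<in> idems T"
  have "inv_into (idems S) ext_pi e = (e, [])"
    using inv_into_f_f[OF inj_ext_pi, of "(e, [])"] e by (simp add: T.idems_ext_S ext_pi_def)
  moreover have "ext_i T A \<theta> (\<theta> e) = (\<theta> e, e, [])" using e by (intro ext_i_eq) simp_all
  ultimately show "\<theta> e = inv_into (carrier A) (ext_i T A \<theta>) (ext_alpha \<theta> (inv_into (idems S) ext_pi e))"
    using inv_into_f_f[OF inj_ext_i, of "\<theta> e"] e by (simp add: ext_alpha_def)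
next
  fix t s a assume t: "t \<in> carrier T" and s: "s \<in> carrier S" "ext_pi s = t" and a: "a \<in> carrier A"
  obtain u where u: "s = (t, u)" using s by (cases s) (auto simp: ext_pi_def)
  obtain e where e: "e \<in> idems T" "ran_idem A a = \<theta> e" "ext_i T A \<theta> a = (a, e, [])"
    using ext_iE[OF a] .
  have N: "(a, e, []) \<in> carrier N" using a e by (simp add: carrier_N)
  have "\<theta> (t \<odot> (e \<odot> sinv T t)) \<star> \<eta> t a = \<eta> t a"
    using t a e by (intro A.ran_idem_eq ran_eta) simp_all
  then have "ext_lambda T A \<theta> \<eta> c s (ext_i T A \<theta> a) = (\<eta> t a, t \<odot> (e \<odot> sinv T t), [])"
    using s u e N t by (simp add: ext_lambda_eq rho_mult_idem)
  also have "\<dots> = ext_i T A \<theta> (\<eta> t a)"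
    using t a e by (intro ext_i_eq[symmetric]) (simp_all add: ran_eta)
  finally show "\<eta> t a = inv_into (carrier A) (ext_i T A \<theta>) (ext_lambda T A \<theta> \<eta> c s (ext_i T A \<theta> a))"
    using inv_into_f_f[OF inj_ext_i, of "\<eta> t a"] t a by simp
qed

end

theorem proposition4p34:
  fixes T :: "'t sgrp" and A :: "'a sgrp"
    and \<theta> :: "'t \<Rightarrow> 'a" and \<eta> :: "'t \<Rightarrow> 'a \<Rightarrow> 'a" and c :: "'t list \<Rightarrow> 'a"
  assumes "inverse_semigroup T"
    and "T_module T A \<theta> \<eta>"
    and "c \<in> order_preserving_cocycles T A \<theta> \<eta> 3"
    and "normalized3 T \<theta> c"
  shows "crossed_module_extension A (ext_i T A \<theta>) (ext_N T A \<theta>) ext_beta (ext_S T) ext_pi T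
           (ext_alpha \<theta>) (ext_lambda T A \<theta> \<eta> c)
       \<and> induces_module A (ext_i T A \<theta>) (ext_S T) ext_pi T
           (ext_alpha \<theta>) (ext_lambda T A \<theta> \<eta> c) \<theta> \<eta>"
proof -
  interpret ordered_cocycle T A \<theta> \<eta> c
    using assms(2-4) by unfold_locales
  show ?thesis using crossed_module_extension_ext induces_module_ext by blast
qed

end
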